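(* Let $G$ be a finite group with $\mathrm{tp}(G) > 4/81 = (2/9)^2$. Then either $G$ is nilpotent or $G$ has a section isomorphic to one of the groups $A_4, D_3, D_5, D_7$. Furthermore, the bound is sharp: for no real number $c<4/81$ is it true that every finite group $G$ with $\mathrm{tp}(G)>c$ is nilpotent or has a section isomorphic to one of $A_4, D_3, D_5, D_7$.
   Context: For a subgroup $H$ of index $n$ in a finite group $G$, $P_G(H) := |\mathrm{DT}_G(H)|/|H|^n$, where $\mathrm{DT}_G(H)$ is the set of all subsets of $G$ that are simultaneously a left transversal (exactly one element of each left coset $gH$) and a right transversal (exactly one element of each right coset $Hg$) of $H$ in $G$. The common transversal probability of $G$ is $\mathrm{tp}(G) := \min_{H\leq G} P_G(H)$, the minimum over all subgroups $H$ of $G$. A section of $G$ is a quotient $U/N$ with $N\unlhd U\leq G$. $D_n$ denotes the dihedral group of order $2n$, and $A_4$ the alternating group of degree 4. *)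

theory Defs
  imports Complex_Main "HOL-Algebra.Sym_Groups"
begin

definition left_transversal :: "('a, 'b) monoid_scheme \<Rightarrow> 'a set \<Rightarrow> 'a set \<Rightarrow> bool" where
  "left_transversal G H T \<longleftrightarrow>
     T \<subseteq> carrier G \<and> (\<forall>g\<in>carrier G. \<exists>!t. t \<in> T \<and> t \<in> g <#\<^bsub>G\<^esub> H)"

definition right_transversal :: "('a, 'b) monoid_scheme \<Rightarrow> 'a set \<Rightarrow> 'a set \<Rightarrow> bool" where
  "right_transversal G H T \<longleftrightarrow>
     T \<subseteq> carrier G \<and> (\<forall>g\<in>carrier G. \<exists>!t. t \<in> T \<and> t \<in> H #>\<^bsub>G\<^esub> g)"

definition DT :: "('a, 'b) monoid_scheme \<Rightarrow> 'a set \<Rightarrow> 'a set set" where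
  "DT G H = {T. left_transversal G H T \<and> right_transversal G H T}"

definition transversal_prob :: "('a, 'b) monoid_scheme \<Rightarrow> 'a set \<Rightarrow> real" where
  "transversal_prob G H = real (card (DT G H)) / real (card H) ^ card (rcosets\<^bsub>G\<^esub> H)"

definition tp :: "('a, 'b) monoid_scheme \<Rightarrow> real" where
  "tp G = Min {transversal_prob G H | H. subgroup H G}"

lemma finite_transversal_probs:
  assumes "finite (carrier G)"
  shows "finite {transversal_prob G H | H. subgroup H G}"
proof -
  have "{transversal_prob G H | H. subgroup H G} \<subseteq> transversal_prob G ` Pow (carrier G)"
    by (auto dest: subgroup.subset)
  then show ?thesis
    using assms finite_subset by blast
qed

primrec lower_central_series :: "('a, 'b) monoid_scheme \<Rightarrow> nat \<Rightarrow> 'a set" where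
  "lower_central_series G 0 = carrier G"
| "lower_central_series G (Suc n) = generate G
     {x \<otimes>\<^bsub>G\<^esub> y \<otimes>\<^bsub>G\<^esub> inv\<^bsub>G\<^esub> x \<otimes>\<^bsub>G\<^esub> inv\<^bsub>G\<^esub> y | x y. x \<in> lower_central_series G n \<and> y \<in> carrier G}"

definition nilpotent_group :: "('a, 'b) monoid_scheme \<Rightarrow> bool" where
  "nilpotent_group G \<longleftrightarrow> group G \<and> (\<exists>n. lower_central_series G n = {\<one>\<^bsub>G\<^esub>})"

definition has_section_iso :: "('a, 'b) monoid_scheme \<Rightarrow> ('c, 'd) monoid_scheme \<Rightarrow> bool" where
  "has_section_iso G K \<longleftrightarrow>
     (\<exists>U N. subgroup U G \<and> N \<lhd> (G\<lparr>carrier := U\<rparr>) \<and> (G\<lparr>carrier := U\<rparr>) Mod N \<cong> K)"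

text \<open>The pair \<open>(i, s)\<close> stands for \<open>r\<^sup>i\<close> if \<open>s\<close> is false and for \<open>r\<^sup>i f\<close> if \<open>s\<close> is true, where
  \<open>r\<close> is a rotation of order \<open>n\<close> and \<open>f\<close> a reflection with \<open>f r f = r\<^sup>-\<^sup>1\<close>.
  The index \<open>n\<close> is half the order of the group.\<close>

definition dihedral_group :: "nat \<Rightarrow> (int \<times> bool) monoid" where
  "dihedral_group n = \<lparr>carrier = {0..<int n} \<times> UNIV,
     mult = (\<lambda>(i, s) (j, t). ((if s then i - j else i + j) mod int n, s \<noteq> t)),
     one = (0, False)\<rparr>"

lemma dihedral_group_is_group:
  assumes "n > 0"
  shows "group (dihedral_group n)"
proof (rule groupI)
  fix x assume "x \<in> carrier (dihedral_group n)"
  then obtain i s where x: "x = (i, s)" "0 \<le> i" "i < int n"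
    by (auto simp: dihedral_group_def)
  let ?y = "(if s then i else (- i) mod int n, s)"
  have "?y \<in> carrier (dihedral_group n)" "?y \<otimes>\<^bsub>dihedral_group n\<^esub> x = \<one>\<^bsub>dihedral_group n\<^esub>"
    using x assms by (auto simp: dihedral_group_def mod_simps)
  then show "\<exists>y\<in>carrier (dihedral_group n). y \<otimes>\<^bsub>dihedral_group n\<^esub> x = \<one>\<^bsub>dihedral_group n\<^esub>"
    by blast
qed (use assms in \<open>auto simp: dihedral_group_def mod_simps algebra_simps split: if_splits\<close>)

lemma order_dihedral_group: "order (dihedral_group n) = 2 * n"
  by (simp add: order_def dihedral_group_def card_cartesian_product)

end

theory Submission
  imports Defs "HOL-Algebra.Left_Coset" "HOL-Algebra.Multiplicative_Group" "HOL-Algebra.Sylow"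
begin

text \<open>Common transversals can be chosen independently in the double cosets of \<open>H\<close>. A double coset \<open>D\<close>
  consists of \<open>k = |D|/|H|\<close> left and \<open>k\<close> right cosets, any two of which meet in \<open>|H|/k\<close> elements, so the
  transversal probability of \<open>H\<close> is the product of the numbers \<open>k!/k\<^sup>k\<close> over all double cosets. In
  particular it does not decrease when \<open>G\<close> is replaced by a subgroup or a quotient.

  A finite group is nilpotent if every maximal subgroup of every subgroup \<open>U\<close> is normal in \<open>U\<close>. If \<open>M\<close> is a
  maximal subgroup of \<open>U\<close> that is not normal, divide out the core of \<open>M\<close>. All double cosets of \<open>M\<close>
  other than \<open>M\<close> itself then have \<open>k \<ge> 2\<close>, and as the product exceeds \<open>4/81\<close> only few possibilities
  remain. If \<open>k = 2\<close> occurs, then \<open>|M| = 2\<close> and the group is dihedral of order 6, 10, 14 or 18. Otherwise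
  there is only one further double coset. For \<open>k = 3\<close> the group acts faithfully on four points and
  contains \<open>A\<^sub>4\<close>. For \<open>k = 4\<close> the bound applied to a subgroup of order 5 shows that this subgroup is
  normal, and an involution of \<open>M\<close> inverts it, which gives \<open>D\<^sub>5\<close>.

  The nonabelian group of order 21 shows that the bound is sharp.\<close>

section \<open>Counting common transversals\<close>

text \<open>For k = 1, ..., 5 the numbers k!/k^k are 1, 1/2, 2/9, 3/32, 24/625, and 24/625 < 4/81 =
  (2/9)^2 < 3/32. So two double cosets with k >= 3 are too many, and so is a single one with k >= 5,
  while the factor 1/2 may occur up to four times because 1/32 < 4/81 < 1/16. Four factors 1/2
  belong to the dihedral group of order 18, which contains D_3.

  Monotonicity is the reason why sections appear: a non-normal maximal subgroup of U can be studied
  modulo its core, and the bound stays available for every subgroup of that quotient, in particular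
  for one of order 5.

  The nilpotency criterion is stated for all subgroups U so that it can be proved by induction, with
  Fitting's argument for two nilpotent normal subgroups.

  In a group of order 21 only subgroups of order 3 can have double cosets with k > 1, and at most
  two of them, each with k = 3; hence the value (2/9)^2 is a lower bound. The four excluded groups
  have even order.

  The counting uses two arbitrary labelling maps l and r, since it is applied to single double
  cosets, which need not be groups.\<close>

definition common_transversals :: "('a \<Rightarrow> 'b) \<Rightarrow> ('a \<Rightarrow> 'c) \<Rightarrow> 'a set \<Rightarrow> 'a set set" where
  "common_transversals l r X =
     {T. T \<subseteq> X \<and> bij_betw l T (l ` X) \<and> bij_betw r T (r ` X)}"

lemma bij_betw_insert_iff:
  assumes "x \<notin> T"
  shows "bij_betw f (insert x T) C \<longleftrightarrow> f x \<in> C \<and> bij_betw f T (C - {f x})"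
proof -
  have "inj_on f (insert x T) \<longleftrightarrow> inj_on f T \<and> f x \<notin> f ` T" using assms by simp
  then show ?thesis unfolding bij_betw_def by (simp only: image_insert) blast
qed

text \<open>Such a T amounts to a bijection from A to B with one of m elements chosen for each
  matched pair. In the induction the element labelled \<open>a\<close> is chosen first, in
  \<open>card B * m\<close> ways; it uses up one label of B, so B has to vary.\<close>

lemma card_bij_subsets:
  assumes "finite X" "finite A" "card B = card A" "finite B"
    and "\<And>a b. a \<in> A \<Longrightarrow> b \<in> B \<Longrightarrow> card {x \<in> X. l x = a \<and> r x = b} = m"
  shows "card {T. T \<subseteq> X \<and> bij_betw l T A \<and> bij_betw r T B} = fact (card A) * m ^ card A"
  using assms(2,3,4,5)
proof (induction A arbitrary: B rule: finite_induct)
  case empty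
  then have "{T. T \<subseteq> X \<and> bij_betw l T {} \<and> bij_betw r T B} = {{}}"
    by (auto simp: bij_betw_def)
  then show ?case by simp
next
  case (insert a A)
  let ?S = "\<lambda>A B. {T. T \<subseteq> X \<and> bij_betw l T A \<and> bij_betw r T B}"
  let ?Y = "{x \<in> X. l x = a \<and> r x \<in> B}"
  have finS: "finite (?S A B)" for A B
    by (rule finite_subset[of _ "Pow X"]) (use assms(1) in auto)
  have finY: "finite ?Y" using assms(1) by auto
  have cardY: "card ?Y = card B * m"
  proof -
    have "?Y = (\<Union>b\<in>B. {x \<in> X. l x = a \<and> r x = b})" by auto
    also have "card \<dots> = (\<Sum>b\<in>B. card {x \<in> X. l x = a \<and> r x = b})"
      using insert.prems(2) assms(1) by (intro card_UN_disjoint) auto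
    also have "\<dots> = card B * m" using insert.prems(3) by simp
    finally show ?thesis .
  qed
  \<comment> \<open>In \<open>insert x T\<close> the element x can be recovered as the only one with
    left label \<open>a\<close>, so choosing x first counts every set exactly once.\<close>
  have bij: "bij_betw (\<lambda>(x, T). insert x T) (SIGMA x:?Y. ?S A (B - {r x})) (?S (insert a A) B)"
  proof (rule bij_betw_imageI)
    show "inj_on (\<lambda>(x, T). insert x T) (SIGMA x:?Y. ?S A (B - {r x}))"
    proof (rule inj_onI, clarsimp)
      fix x T x' T'
      assume h: "insert x T = insert x' T'" "l x' = l x" "a = l x"
        "bij_betw l T A" "bij_betw l T' A"
      have "l x \<notin> l ` T" "l x' \<notin> l ` T'" using h insert.hyps by (auto simp: bij_betw_def)
      then show "x = x' \<and> T = T'" using h by (metis image_eqI insert_iff insert_ident)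
    qed
    show "(\<lambda>(x, T). insert x T) ` (SIGMA x:?Y. ?S A (B - {r x})) = ?S (insert a A) B"
    proof (intro equalityI subsetI)
      fix V assume "V \<in> (\<lambda>(x, T). insert x T) ` (SIGMA x:?Y. ?S A (B - {r x}))"
      then obtain x T where x: "x \<in> ?Y" "T \<in> ?S A (B - {r x})" "V = insert x T" by auto
      then have "x \<notin> T" by (auto simp: bij_betw_def)
      then show "V \<in> ?S (insert a A) B"
        using x insert.hyps(2) by (simp add: bij_betw_insert_iff)
    next
      fix V assume V: "V \<in> ?S (insert a A) B"
      then obtain x where x: "x \<in> V" "l x = a"
        by (auto simp: bij_betw_def) (metis image_iff insertI1)
      then have "V = insert x (V - {x})" by auto
      moreover have "(x, V - {x}) \<in> (SIGMA x:?Y. ?S A (B - {r x}))"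
        using V x insert.hyps(2) bij_betw_insert_iff[of x "V - {x}" l "insert a A"]
          bij_betw_insert_iff[of x "V - {x}" r B]
        by (auto simp: insert_absorb)
      ultimately show "V \<in> (\<lambda>(x, T). insert x T) ` (SIGMA x:?Y. ?S A (B - {r x}))"
        by (intro image_eqI[where x = "(x, V - {x})"]) (simp only: prod.case)
    qed
  qed
  have "card (?S (insert a A) B) = card (SIGMA x:?Y. ?S A (B - {r x}))"
    using bij_betw_same_card[OF bij] by simp
  also have "\<dots> = (\<Sum>x\<in>?Y. card (?S A (B - {r x})))"
    using finY finS by (intro card_SigmaI) auto
  also have "\<dots> = (\<Sum>x\<in>?Y. fact (card A) * m ^ card A)"
    using insert.prems insert.hyps by (intro sum.cong refl insert.IH) auto
  also have "\<dots> = fact (card (insert a A)) * m ^ card (insert a A)"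
    using insert.prems(1) insert.hyps by (simp only: sum_constant cardY) (simp add: algebra_simps)
  finally show ?case .
qed

lemma card_common_transversals:
  assumes "finite X" "card (l ` X) = k" "card (r ` X) = k"
    and "\<And>x y. x \<in> X \<Longrightarrow> y \<in> X \<Longrightarrow> card {z \<in> X. l z = l x \<and> r z = r y} = m"
  shows "card (common_transversals l r X) = fact k * m ^ k"
  unfolding common_transversals_def using assms
  by (subst card_bij_subsets[where m = m]) auto

text \<open>By \<open>sep\<close> distinct blocks share no label, so a collision or a missing label
  is visible inside a single block.\<close>

lemma bij_betw_image_Union:
  assumes T: "T \<subseteq> \<Union>\<D>"
    and sep: "\<And>D E x y. D \<in> \<D> \<Longrightarrow> E \<in> \<D> \<Longrightarrow> x \<in> D \<Longrightarrow> y \<in> E \<Longrightarrow> f x = f y \<Longrightarrow> D = E"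
  shows "bij_betw f T (f ` \<Union>\<D>) \<longleftrightarrow> (\<forall>D\<in>\<D>. bij_betw f (T \<inter> D) (f ` D))"
proof
  assume b: "bij_betw f T (f ` \<Union>\<D>)"
  show "\<forall>D\<in>\<D>. bij_betw f (T \<inter> D) (f ` D)"
  proof
    fix D assume D: "D \<in> \<D>"
    have "f ` D \<subseteq> f ` (T \<inter> D)"
    proof
      fix y assume "y \<in> f ` D"
      then obtain x where x: "x \<in> D" "y = f x" by auto
      then have "f x \<in> f ` T" using b D by (auto simp: bij_betw_def)
      then obtain t where t: "t \<in> T" "f x = f t" by auto
      then obtain E where "E \<in> \<D>" "t \<in> E" using T by auto
      then have "t \<in> D" using sep[OF D _ x(1) _ t(2)] by auto
      then show "y \<in> f ` (T \<inter> D)" using x t by auto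
    qed
    then show "bij_betw f (T \<inter> D) (f ` D)"
      using b by (auto simp: bij_betw_def intro: inj_on_subset)
  qed
next
  assume h: "\<forall>D\<in>\<D>. bij_betw f (T \<inter> D) (f ` D)"
  have "inj_on f T"
  proof (rule inj_onI)
    fix x y assume xy: "x \<in> T" "y \<in> T" "f x = f y"
    then obtain D E where "D \<in> \<D>" "x \<in> D" "E \<in> \<D>" "y \<in> E"
      using T by (meson UnionE subsetD)
    then have D: "D \<in> \<D>" "x \<in> D" "y \<in> D" using sep[of D E x y] xy by auto
    then show "x = y" using h xy by (auto simp: bij_betw_def inj_on_def)
  qed
  moreover have "f ` T = f ` \<Union>\<D>"
  proof -
    have "f ` D = f ` (T \<inter> D)" if "D \<in> \<D>" for D using h that by (auto simp: bij_betw_def)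
    then have "f ` \<Union>\<D> = (\<Union>D\<in>\<D>. f ` (T \<inter> D))" by (simp add: image_Union)
    also have "\<dots> = f ` (\<Union>D\<in>\<D>. T \<inter> D)" by (simp only: image_UN)
    also have "(\<Union>D\<in>\<D>. T \<inter> D) = T" using T by auto
    finally show ?thesis by simp
  qed
  ultimately show "bij_betw f T (f ` \<Union>\<D>)" by (simp add: bij_betw_def)
qed

text \<open>Restricting to the blocks and uniting choices made in the blocks are mutually inverse,
  which identifies the common transversals of the union with a product of sets.\<close>

lemma card_common_transversals_Union:
  assumes fin: "finite (\<Union>\<D>)" "finite \<D>"
    and sep: "\<And>D E x y. D \<in> \<D> \<Longrightarrow> E \<in> \<D> \<Longrightarrow> x \<in> D \<Longrightarrow> y \<in> E \<Longrightarrow> l x = l y \<or> r x = r y \<Longrightarrow> D = E"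
  shows "card (common_transversals l r (\<Union>\<D>)) = (\<Prod>D\<in>\<D>. card (common_transversals l r D))"
proof -
  let ?P = "PiE \<D> (common_transversals l r)"
  have iff: "T \<in> common_transversals l r (\<Union>\<D>) \<longleftrightarrow>
      T \<subseteq> \<Union>\<D> \<and> (\<forall>D\<in>\<D>. T \<inter> D \<in> common_transversals l r D)" for T
    unfolding common_transversals_def
    using bij_betw_image_Union[of T \<D> l] bij_betw_image_Union[of T \<D> r] sep by auto
  have int: "(\<Union>E\<in>\<D>. F E) \<inter> D = F D" if F: "F \<in> ?P" and D: "D \<in> \<D>" for F D
  proof -
    have sub: "F E \<subseteq> E" if "E \<in> \<D>" for E
      using F that by (auto simp: common_transversals_def PiE_def Pi_def)
    show ?thesis
    proof (intro equalityI subsetI)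
      fix x assume "x \<in> (\<Union>E\<in>\<D>. F E) \<inter> D"
      then obtain E where "E \<in> \<D>" "x \<in> F E" "x \<in> D" by auto
      then show "x \<in> F D" using sep[of E D x x] sub D by auto
    qed (use sub D in auto)
  qed
  have "bij_betw (\<lambda>T. \<lambda>D\<in>\<D>. T \<inter> D) (common_transversals l r (\<Union>\<D>)) ?P"
  proof (rule bij_betw_byWitness[where f' = "\<lambda>F. \<Union>D\<in>\<D>. F D"])
    show "\<forall>T\<in>common_transversals l r (\<Union>\<D>). (\<Union>D\<in>\<D>. (\<lambda>D\<in>\<D>. T \<inter> D) D) = T"
      using iff by auto
    show "\<forall>F\<in>?P. (\<lambda>D\<in>\<D>. (\<Union>D\<in>\<D>. F D) \<inter> D) = F"
    proof
      fix F assume "F \<in> ?P"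
      then show "(\<lambda>D\<in>\<D>. (\<Union>D\<in>\<D>. F D) \<inter> D) = F"
        using int by (auto simp: PiE_def extensional_def fun_eq_iff)
    qed
    show "(\<lambda>T. \<lambda>D\<in>\<D>. T \<inter> D) ` common_transversals l r (\<Union>\<D>) \<subseteq> ?P"
      using iff by auto
    show "(\<lambda>F. \<Union>D\<in>\<D>. F D) ` ?P \<subseteq> common_transversals l r (\<Union>\<D>)"
    proof clarify
      fix F assume F: "F \<in> ?P"
      then have "(\<Union>D\<in>\<D>. F D) \<subseteq> \<Union>\<D>"
        by (fastforce simp: common_transversals_def PiE_def Pi_def)
      then show "(\<Union>D\<in>\<D>. F D) \<in> common_transversals l r (\<Union>\<D>)"
        using F int[OF F] by (subst iff) auto
    qed
  qed
  then show ?thesis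
    using card_PiE[OF fin(2)] bij_betw_same_card by metis
qed

section \<open>Double cosets and the product formula\<close>

definition double_coset :: "('a, 'b) monoid_scheme \<Rightarrow> 'a set \<Rightarrow> 'a \<Rightarrow> 'a set" where
  "double_coset G H g = {a \<otimes>\<^bsub>G\<^esub> g \<otimes>\<^bsub>G\<^esub> b | a b. a \<in> H \<and> b \<in> H}"

definition double_cosets :: "('a, 'b) monoid_scheme \<Rightarrow> 'a set \<Rightarrow> 'a set set" where
  "double_cosets G H = double_coset G H ` carrier G"

text \<open>The share of one double coset: if |H| = k m, a double coset of k left cosets has k! m^k
  common transversals, its part of the denominator is (k m)^k, and m cancels.\<close>

definition transversal_factor :: "nat \<Rightarrow> real" where
  "transversal_factor k = fact k / real k ^ k"

lemma card_by_fibres: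
  assumes "finite S" "\<And>x. x \<in> S \<Longrightarrow> card {y \<in> S. f y = f x} = m"
  shows "card S = card (f ` S) * m"
proof -
  have "card S = (\<Sum>c\<in>f ` S. \<Sum>y\<in>{y \<in> S. f y = c}. 1)"
    using sum.image_gen[OF assms(1), of "\<lambda>_. 1::nat" f] by simp
  also have "\<dots> = (\<Sum>c\<in>f ` S. m)" using assms(2) by (intro sum.cong) auto
  finally show ?thesis by simp
qed

context group
begin

section \<open>Membership in cosets\<close>

lemma subgroup_mult_left_iff:
  assumes "subgroup H G" "h \<in> H" "x \<in> carrier G"
  shows "h \<otimes> x \<in> H \<longleftrightarrow> x \<in> H"
proof
  assume "h \<otimes> x \<in> H"
  then have "inv h \<otimes> (h \<otimes> x) \<in> H"
    using assms subgroup.m_closed subgroup.m_inv_closed by metis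
  then show "x \<in> H"
    using assms subgroup.mem_carrier[OF assms(1)] by (simp add: m_assoc[symmetric])
qed (use assms subgroup.m_closed in metis)

lemma subgroup_mult_right_iff:
  assumes "subgroup H G" "h \<in> H" "x \<in> carrier G"
  shows "x \<otimes> h \<in> H \<longleftrightarrow> x \<in> H"
proof
  assume "x \<otimes> h \<in> H"
  then have "(x \<otimes> h) \<otimes> inv h \<in> H"
    using assms subgroup.m_closed subgroup.m_inv_closed by metis
  then show "x \<in> H"
    using assms subgroup.mem_carrier[OF assms(1)] by (simp add: m_assoc)
qed (use assms subgroup.m_closed in metis)

lemma mem_l_coset_iff:
  assumes "subgroup H G" "x \<in> carrier G" "y \<in> carrier G"
  shows "y \<in> x <# H \<longleftrightarrow> inv x \<otimes> y \<in> H"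
proof
  assume "y \<in> x <# H"
  then show "inv x \<otimes> y \<in> H"
    using assms subgroup.mem_carrier[OF assms(1)]
    by (auto simp: l_coset_def m_assoc[symmetric])
next
  assume "inv x \<otimes> y \<in> H"
  then show "y \<in> x <# H"
    using assms by (auto simp: l_coset_def m_assoc[symmetric] intro!: bexI[of _ "inv x \<otimes> y"])
qed

lemma mem_r_coset_iff:
  assumes "subgroup H G" "x \<in> carrier G" "y \<in> carrier G"
  shows "y \<in> H #> x \<longleftrightarrow> y \<otimes> inv x \<in> H"
proof
  assume "y \<in> H #> x"
  then show "y \<otimes> inv x \<in> H"
    using assms subgroup.mem_carrier[OF assms(1)]
    by (auto simp: r_coset_def m_assoc)
next
  assume "y \<otimes> inv x \<in> H"
  then show "y \<in> H #> x"
    using assms by (auto simp: r_coset_def m_assoc intro!: bexI[of _ "y \<otimes> inv x"])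
qed

lemma l_coset_eq_iff:
  assumes "subgroup H G" "x \<in> carrier G" "y \<in> carrier G"
  shows "y <# H = x <# H \<longleftrightarrow> y \<in> x <# H"
  using assms by (metis lcos_self l_repr_independence)

lemma r_coset_eq_iff:
  assumes "subgroup H G" "x \<in> carrier G" "y \<in> carrier G"
  shows "H #> y = H #> x \<longleftrightarrow> y \<in> H #> x"
  using assms by (metis rcos_self repr_independence)

section \<open>The partition into double cosets\<close>

lemma double_coset_subset:
  assumes "subgroup H G" "g \<in> carrier G"
  shows "double_coset G H g \<subseteq> carrier G"
  using assms subgroup.mem_carrier[OF assms(1)] by (auto simp: double_coset_def)

lemma double_coset_self:
  assumes "subgroup H G" "g \<in> carrier G"
  shows "g \<in> double_coset G H g"
proof -
  have "g = \<one> \<otimes> g \<otimes> \<one>" using assms(2) by simp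
  then show ?thesis using subgroup.one_closed[OF assms(1)] unfolding double_coset_def by blast
qed

lemma double_coset_eq:
  assumes H: "subgroup H G" and g: "g \<in> carrier G" and x: "x \<in> double_coset G H g"
  shows "double_coset G H x = double_coset G H g"
proof -
  have sub: "double_coset G H (a \<otimes> y \<otimes> b) \<subseteq> double_coset G H y"
    if "y \<in> carrier G" "a \<in> H" "b \<in> H" for a b y
  proof
    fix z assume "z \<in> double_coset G H (a \<otimes> y \<otimes> b)"
    then obtain c d where cd: "c \<in> H" "d \<in> H" "z = c \<otimes> (a \<otimes> y \<otimes> b) \<otimes> d"
      by (auto simp: double_coset_def)
    have "z = (c \<otimes> a) \<otimes> y \<otimes> (b \<otimes> d)"
      using cd that subgroup.mem_carrier[OF H] by (simp add: m_assoc)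
    then show "z \<in> double_coset G H y"
      using cd that subgroup.m_closed[OF H] by (auto simp: double_coset_def)
  qed
  obtain a b where ab: "a \<in> H" "b \<in> H" "x = a \<otimes> g \<otimes> b"
    using x by (auto simp: double_coset_def)
  have c: "a \<in> carrier G" "b \<in> carrier G" using ab subgroup.mem_carrier[OF H] by auto
  then have "g = inv a \<otimes> x \<otimes> inv b"
    using g ab by (simp add: m_assoc) (simp add: m_assoc[symmetric])
  then have "double_coset G H g \<subseteq> double_coset G H x"
    using sub[of x "inv a" "inv b"] ab c g subgroup.m_inv_closed[OF H] by auto
  then show ?thesis using sub[of g a b] ab g by auto
qed

lemma l_coset_subset_double_coset:
  assumes "subgroup H G" "g \<in> carrier G"
  shows "g <# H \<subseteq> double_coset G H g"
proof
  fix x assume "x \<in> g <# H"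
  then obtain h where "h \<in> H" "x = \<one> \<otimes> g \<otimes> h"
    using assms(2) by (auto simp: l_coset_def)
  then show "x \<in> double_coset G H g"
    using subgroup.one_closed[OF assms(1)] by (auto simp: double_coset_def)
qed

lemma r_coset_subset_double_coset:
  assumes "subgroup H G" "g \<in> carrier G"
  shows "H #> g \<subseteq> double_coset G H g"
proof
  fix x assume "x \<in> H #> g"
  then obtain h where "h \<in> H" "x = h \<otimes> g \<otimes> \<one>"
    using assms subgroup.mem_carrier[OF assms(1)] by (auto simp: r_coset_def)
  then show "x \<in> double_coset G H g"
    using subgroup.one_closed[OF assms(1)] by (auto simp: double_coset_def)
qed

lemma Union_double_cosets:
  assumes "subgroup H G"
  shows "\<Union>(double_cosets G H) = carrier G"
proof (intro equalityI subsetI)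
  fix x assume "x \<in> carrier G"
  then show "x \<in> \<Union>(double_cosets G H)"
    unfolding double_cosets_def using double_coset_self[OF assms] by (intro UN_I)
next
  fix x assume "x \<in> \<Union>(double_cosets G H)"
  then obtain g where "g \<in> carrier G" "x \<in> double_coset G H g" by (auto simp: double_cosets_def)
  then show "x \<in> carrier G" by (rule subsetD[OF double_coset_subset[OF assms]])
qed

lemma double_cosets_eqI:
  assumes "subgroup H G" "D \<in> double_cosets G H" "E \<in> double_cosets G H" "x \<in> D" "x \<in> E"
  shows "D = E"
proof -
  obtain g h where "g \<in> carrier G" "D = double_coset G H g" "h \<in> carrier G" "E = double_coset G H h"
    using assms(2,3) by (auto simp: double_cosets_def)
  then show ?thesis
    using double_coset_eq[OF assms(1), of g x] double_coset_eq[OF assms(1), of h x] assms(4,5) by simp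
qed

lemma double_cosets_memD:
  assumes "subgroup H G" "D \<in> double_cosets G H" "x \<in> D"
  shows "x \<in> carrier G" "D = double_coset G H x"
proof -
  obtain g where g: "g \<in> carrier G" "D = double_coset G H g"
    using assms(2) by (auto simp: double_cosets_def)
  show "x \<in> carrier G" using double_coset_subset[OF assms(1) g(1)] assms(3) g(2) by blast
  show "D = double_coset G H x" using double_coset_eq[OF assms(1) g(1)] assms(3) g(2) by simp
qed

text \<open>Every left and every right coset lies in one double coset. This is the separation
  hypothesis of \<open>card_common_transversals_Union\<close>.\<close>

lemma double_cosets_coset_sep:
  assumes H: "subgroup H G" and D: "D \<in> double_cosets G H" "E \<in> double_cosets G H"
    and xy: "x \<in> D" "y \<in> E" and eq: "x <# H = y <# H \<or> H #> x = H #> y"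
  shows "D = E"
proof -
  note [simp] = double_cosets_memD(1)[OF H D(1) xy(1)] double_cosets_memD(1)[OF H D(2) xy(2)]
  have "x \<in> y <# H \<or> x \<in> H #> y"
    using eq l_coset_eq_iff[OF H, of y x] r_coset_eq_iff[OF H, of y x] by auto
  then have "x \<in> double_coset G H y"
    using l_coset_subset_double_coset[OF H, of y] r_coset_subset_double_coset[OF H, of y] by auto
  then show ?thesis
    using double_cosets_eqI[OF H D xy(1)] double_cosets_memD(2)[OF H D(2) xy(2)] by simp
qed

lemma DT_eq_common_transversals:
  assumes H: "subgroup H G"
  shows "DT G H = common_transversals (\<lambda>x. x <# H) (\<lambda>x. H #> x) (carrier G)"
proof -
  \<comment> \<open>Stated for any coset map c with the usual equality criterion, so that left and
    right cosets are treated at once.\<close>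
  have bij_iff: "bij_betw c T (c ` carrier G) \<longleftrightarrow> (\<forall>g\<in>carrier G. \<exists>!t. t \<in> T \<and> t \<in> c g)"
    if T: "T \<subseteq> carrier G"
      and c: "\<And>x y. x \<in> carrier G \<Longrightarrow> y \<in> carrier G \<Longrightarrow> c y = c x \<longleftrightarrow> y \<in> c x"
    for c :: "'a \<Rightarrow> 'a set" and T
  proof -
    have "(\<forall>g\<in>carrier G. \<exists>!t. t \<in> T \<and> t \<in> c g) \<longleftrightarrow> (\<forall>g\<in>carrier G. \<exists>!t. t \<in> T \<and> c t = c g)"
      using T c by (metis subsetD)
    also have "\<dots> \<longleftrightarrow> bij_betw c T (c ` carrier G)"
    proof
      assume h: "\<forall>g\<in>carrier G. \<exists>!t. t \<in> T \<and> c t = c g"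
      have "inj_on c T" using h T by (metis inj_onI subsetD)
      moreover have "c ` carrier G \<subseteq> c ` T"
      proof
        fix y assume "y \<in> c ` carrier G"
        then obtain g where "g \<in> carrier G" "y = c g" by auto
        then show "y \<in> c ` T" using h by (metis image_eqI)
      qed
      ultimately show "bij_betw c T (c ` carrier G)" using T by (auto simp: bij_betw_def)
    next
      assume b: "bij_betw c T (c ` carrier G)"
      show "\<forall>g\<in>carrier G. \<exists>!t. t \<in> T \<and> c t = c g"
      proof
        fix g assume "g \<in> carrier G"
        then have "c g \<in> c ` T" using b by (auto simp: bij_betw_def)
        then obtain t where "t \<in> T" "c t = c g" by auto
        then show "\<exists>!t. t \<in> T \<and> c t = c g" using b by (metis bij_betw_def inj_onD)
      qed
    qed
    finally show ?thesis by simp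
  qed
  show ?thesis
  proof (rule Set.set_eqI)
    fix T
    show "T \<in> DT G H \<longleftrightarrow> T \<in> common_transversals (\<lambda>x. x <# H) (\<lambda>x. H #> x) (carrier G)"
    proof (cases "T \<subseteq> carrier G")
      case True
      show ?thesis
        using bij_iff[OF True, where c = "\<lambda>x. x <# H", OF l_coset_eq_iff[OF H]]
          bij_iff[OF True, where c = "\<lambda>x. H #> x", OF r_coset_eq_iff[OF H]]
        by (simp add: DT_def left_transversal_def right_transversal_def common_transversals_def True)
    qed (simp add: DT_def left_transversal_def common_transversals_def)
  qed
qed

section \<open>Counting inside one double coset\<close>

lemma card_l_coset:
  assumes "subgroup H G" "x \<in> carrier G"
  shows "card (x <# H) = card H"
proof -
  have "inj_on (\<lambda>h. x \<otimes> h) H"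
    using assms subgroup.mem_carrier[OF assms(1)] by (auto intro!: inj_onI)
  moreover have "x <# H = (\<lambda>h. x \<otimes> h) ` H" by (auto simp: l_coset_def)
  ultimately show ?thesis by (simp add: card_image)
qed

lemma card_r_coset:
  assumes "subgroup H G" "x \<in> carrier G"
  shows "card (H #> x) = card H"
proof -
  have "inj_on (\<lambda>h. h \<otimes> x) H"
    using assms subgroup.mem_carrier[OF assms(1)] by (auto intro!: inj_onI)
  moreover have "H #> x = (\<lambda>h. h \<otimes> x) ` H" by (auto simp: r_coset_def)
  ultimately show ?thesis by (simp add: card_image)
qed

text \<open>If a = p g q and b = s g t with p, q, s, t in H, then aH = pgH and Hb = Hgt. Multiplying
  by p^-1 on the left and t^-1 on the right therefore carries the intersection of aH and Hb to that
  of gH and Hg.\<close>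

lemma card_l_coset_Int_r_coset:
  assumes H: "subgroup H G" and g: "g \<in> carrier G"
    and a: "a \<in> double_coset G H g" and b: "b \<in> double_coset G H g"
  shows "card ((a <# H) \<inter> (H #> b)) = card ((g <# H) \<inter> (H #> g))"
proof -
  note HG [simp] = subgroup.mem_carrier[OF H]
  note [simp] = subgroup.m_closed[OF H] subgroup.m_inv_closed[OF H] g
  obtain p q where pq: "p \<in> H" "q \<in> H" "a = p \<otimes> g \<otimes> q" using a by (auto simp: double_coset_def)
  obtain s t where st: "s \<in> H" "t \<in> H" "b = s \<otimes> g \<otimes> t" using b by (auto simp: double_coset_def)
  have aH: "x \<in> a <# H \<longleftrightarrow> inv p \<otimes> x \<in> g <# H" if x: "x \<in> carrier G" for x
  proof -
    have "inv a \<otimes> x \<in> H \<longleftrightarrow> q \<otimes> (inv a \<otimes> x) \<in> H"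
      using pq x subgroup_mult_left_iff[OF H, of q "inv a \<otimes> x"] by simp
    also have "q \<otimes> (inv a \<otimes> x) = inv g \<otimes> (inv p \<otimes> x)"
      using pq x by (simp add: inv_mult_group m_assoc[symmetric])
    finally show ?thesis using pq x by (simp add: mem_l_coset_iff[OF H])
  qed
  have Hb: "x \<in> H #> b \<longleftrightarrow> x \<otimes> inv t \<in> H #> g" if x: "x \<in> carrier G" for x
  proof -
    have "x \<otimes> inv b \<in> H \<longleftrightarrow> (x \<otimes> inv b) \<otimes> s \<in> H"
      using st x subgroup_mult_right_iff[OF H, of s "x \<otimes> inv b"] by simp
    also have "(x \<otimes> inv b) \<otimes> s = (x \<otimes> inv t) \<otimes> inv g"
      using st x by (simp add: inv_mult_group m_assoc)
    finally show ?thesis using st x by (simp add: mem_r_coset_iff[OF H])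
  qed
  have gl: "x \<otimes> inv t \<in> g <# H \<longleftrightarrow> x \<in> g <# H" if x: "x \<in> carrier G" for x
    using x st subgroup_mult_right_iff[OF H, of "inv t" "inv g \<otimes> x"]
    by (simp add: mem_l_coset_iff[OF H] m_assoc)
  have gr: "inv p \<otimes> x \<in> H #> g \<longleftrightarrow> x \<in> H #> g" if x: "x \<in> carrier G" for x
    using x pq subgroup_mult_left_iff[OF H, of "inv p" "x \<otimes> inv g"]
    by (simp add: mem_r_coset_iff[OF H] m_assoc)
  have sub: "x <# H \<subseteq> carrier G" "H #> x \<subseteq> carrier G" if "x \<in> carrier G" for x
    using that by (auto simp: l_coset_def r_coset_def)
  have ac: "a \<in> carrier G" "b \<in> carrier G" using pq st by auto
  have cancel: "u \<otimes> (inv u \<otimes> x \<otimes> inv v) \<otimes> v = x"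
    if "u \<in> carrier G" "v \<in> carrier G" "x \<in> carrier G" for u v x
  proof -
    have "u \<otimes> (inv u \<otimes> x \<otimes> inv v) \<otimes> v = (u \<otimes> inv u) \<otimes> x \<otimes> (inv v \<otimes> v)"
      using that by (simp only: m_assoc inv_closed m_closed)
    then show ?thesis using that by simp
  qed
  have cancel': "inv p \<otimes> (p \<otimes> x \<otimes> t) \<otimes> inv t = x" if "x \<in> carrier G" for x
    using cancel[of "inv p" "inv t" x] that pq st by simp
  have "bij_betw (\<lambda>x. inv p \<otimes> x \<otimes> inv t) ((a <# H) \<inter> (H #> b)) ((g <# H) \<inter> (H #> g))"
  proof (rule bij_betw_byWitness[where f' = "\<lambda>x. p \<otimes> x \<otimes> t"])
    show "\<forall>x\<in>(a <# H) \<inter> (H #> b). p \<otimes> (inv p \<otimes> x \<otimes> inv t) \<otimes> t = x"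
    proof
      fix x assume "x \<in> (a <# H) \<inter> (H #> b)"
      then have "x \<in> carrier G" using sub(1)[OF ac(1)] by auto
      then show "p \<otimes> (inv p \<otimes> x \<otimes> inv t) \<otimes> t = x" using cancel HG pq(1) st(2) by metis
    qed
    show "\<forall>x\<in>(g <# H) \<inter> (H #> g). inv p \<otimes> (p \<otimes> x \<otimes> t) \<otimes> inv t = x"
    proof
      fix x assume "x \<in> (g <# H) \<inter> (H #> g)"
      then have "x \<in> carrier G" using sub(1)[OF g] by auto
      then show "inv p \<otimes> (p \<otimes> x \<otimes> t) \<otimes> inv t = x" by (rule cancel')
    qed
    show "(\<lambda>x. inv p \<otimes> x \<otimes> inv t) ` ((a <# H) \<inter> (H #> b)) \<subseteq> (g <# H) \<inter> (H #> g)"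
    proof clarify
      fix x assume x: "x \<in> a <# H" "x \<in> H #> b"
      then have xc: "x \<in> carrier G" using sub[OF ac(1)] by auto
      then show "inv p \<otimes> x \<otimes> inv t \<in> (g <# H) \<inter> (H #> g)"
        using x aH[OF xc] Hb[OF xc] gl[of "inv p \<otimes> x"] gr[of "x \<otimes> inv t"] pq st
        by (auto simp: m_assoc)
    qed
    show "(\<lambda>x. p \<otimes> x \<otimes> t) ` ((g <# H) \<inter> (H #> g)) \<subseteq> (a <# H) \<inter> (H #> b)"
    proof clarify
      fix x assume x: "x \<in> g <# H" "x \<in> H #> g"
      then have xc: "x \<in> carrier G" using sub[OF g] by auto
      have e1: "inv p \<otimes> (p \<otimes> x \<otimes> t) \<otimes> inv t = x"
        using cancel'[OF xc] .
      have e2: "p \<otimes> x \<otimes> t \<otimes> inv t = p \<otimes> x" "inv p \<otimes> (p \<otimes> x) = x"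
        using xc pq st by (simp add: m_assoc) (use xc pq in \<open>simp add: m_assoc[symmetric]\<close>)
      show "p \<otimes> x \<otimes> t \<in> (a <# H) \<inter> (H #> b)"
        using x aH[of "p \<otimes> x \<otimes> t"] Hb[of "p \<otimes> x \<otimes> t"] gl[of "inv p \<otimes> (p \<otimes> x \<otimes> t)"] 
          gr[of "p \<otimes> x"] pq st xc e1 e2
        by auto
    qed
  qed
  then show ?thesis by (rule bij_betw_same_card)
qed

text \<open>Left and right cosets all have |H| elements, so D splits into equally many of either
  kind. As any left and any right coset in D meet in m elements, the k right cosets cut gH into k
  pieces of size m.\<close>

lemma double_coset_counts:
  fixes H :: "'a set"
  assumes H: "subgroup H G" and fin: "finite (carrier G)" and g: "g \<in> carrier G"
  defines "D \<equiv> double_coset G H g"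
  defines "k \<equiv> card D div card H" and "m \<equiv> card ((g <# H) \<inter> (H #> g))"
  shows "card D = k * card H" "card ((\<lambda>x. x <# H) ` D) = k" "card ((\<lambda>x. H #> x) ` D) = k"
    "k * m = card H" "card (common_transversals (\<lambda>x. x <# H) (\<lambda>x. H #> x) D) = fact k * m ^ k"
proof -
  have DG: "D \<subseteq> carrier G" unfolding D_def using double_coset_subset[OF H g] .
  then have finD: "finite D" using fin finite_subset by auto
  have Hpos: "card H > 0" using subgroup.finite_imp_card_positive[OF H fin] .
  have Dx: "double_coset G H x = D" if "x \<in> D" for x
    using that double_coset_eq[OF H g] by (auto simp: D_def)
  have lx: "{y \<in> D. y <# H = x <# H} = x <# H" if "x \<in> D" for x
    using that DG l_coset_eq_iff[OF H, of x] l_coset_subset_double_coset[OF H, of x] Dx[of x]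
    by (auto simp: subset_iff)
  have rx: "{y \<in> D. H #> y = H #> x} = H #> x" if "x \<in> D" for x
    using that DG r_coset_eq_iff[OF H, of x] r_coset_subset_double_coset[OF H, of x] Dx[of x]
    by (auto simp: subset_iff)
  have "card D = card ((\<lambda>x. x <# H) ` D) * card H"
    using DG by (intro card_by_fibres finD) (auto simp: lx card_l_coset[OF H] subset_iff)
  then show l: "card ((\<lambda>x. x <# H) ` D) = k" and "card D = k * card H"
    using Hpos by (auto simp: k_def)
  have "card D = card ((\<lambda>x. H #> x) ` D) * card H"
    using DG by (intro card_by_fibres finD) (auto simp: rx card_r_coset[OF H] subset_iff)
  then show r: "card ((\<lambda>x. H #> x) ` D) = k"
    using Hpos by (auto simp: k_def)
  have fib: "card {z \<in> D. z <# H = x <# H \<and> H #> z = H #> y} = m" if "x \<in> D" "y \<in> D" for x y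
  proof -
    have "{z \<in> D. z <# H = x <# H \<and> H #> z = H #> y} =
        {z \<in> D. z <# H = x <# H} \<inter> {z \<in> D. H #> z = H #> y}" by auto
    also have "\<dots> = (x <# H) \<inter> (H #> y)" using lx[OF that(1)] rx[OF that(2)] by simp
    finally show ?thesis
      using card_l_coset_Int_r_coset[OF H g] that by (auto simp: m_def D_def)
  qed
  show "card (common_transversals (\<lambda>x. x <# H) (\<lambda>x. H #> x) D) = fact k * m ^ k"
    by (rule card_common_transversals[OF finD l r fib])
  have gD: "g \<in> D" using double_coset_self[OF H g] by (simp add: D_def)
  \<comment> \<open>Positivity ensures that gH meets every right coset in D, so that exactly k
    pieces are counted below.\<close>
  have "m > 0"
  proof -
    have "g \<in> (g <# H) \<inter> (H #> g)" using lcos_self[OF g H] rcos_self[OF g H] by auto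
    moreover have "finite (g <# H)"
      using l_coset_subset_double_coset[OF H g] finD finite_subset by (auto simp: D_def)
    ultimately show ?thesis unfolding m_def by (metis card_gt_0_iff empty_iff finite_Int)
  qed
  have glD: "g <# H \<subseteq> D" using l_coset_subset_double_coset[OF H g] by (simp add: D_def)
  have "card (g <# H) = card ((\<lambda>x. H #> x) ` (g <# H)) * m"
  proof (rule card_by_fibres)
    show "finite (g <# H)" using glD finD finite_subset by auto
    fix x assume "x \<in> g <# H"
    then have "x \<in> D" using glD by auto
    then show "card {y \<in> g <# H. H #> y = H #> x} = m"
    proof -
      have "{y \<in> g <# H. H #> y = H #> x} = {y \<in> D. y <# H = g <# H \<and> H #> y = H #> x}"
        using lx[OF gD] by (auto simp: set_eq_iff)
      then show ?thesis using fib[OF gD \<open>x \<in> D\<close>] by simp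
    qed
  qed
  moreover have "(\<lambda>x. H #> x) ` (g <# H) = (\<lambda>x. H #> x) ` D"
  proof (rule equalityI[OF image_mono[OF glD]], rule subsetI)
    fix y assume "y \<in> (\<lambda>x. H #> x) ` D"
    then obtain x where x: "x \<in> D" "y = H #> x" by auto
    have "{z \<in> D. z <# H = g <# H \<and> H #> z = H #> x} \<noteq> {}"
      using fib[OF gD x(1)] \<open>m > 0\<close> by (metis card.empty less_numeral_extra(3))
    then obtain z where "z \<in> {y \<in> D. y <# H = g <# H}" "H #> z = H #> x" by auto
    then show "y \<in> (\<lambda>x. H #> x) ` (g <# H)"
      unfolding lx[OF gD] x(2) by (metis image_eqI)
  qed
  ultimately show "k * m = card H" using r card_l_coset[OF H g] by simp
qed

text \<open>The exponent, the index of H, is the sum of the numbers k of right cosets in the double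
  cosets. The denominator can thus be distributed, and each double coset contributes k! m^k / (k
  m)^k.\<close>

theorem transversal_prob_eq:
  assumes H: "subgroup H G" and fin: "finite (carrier G)"
  shows "transversal_prob G H =
    (\<Prod>D\<in>double_cosets G H. transversal_factor (card D div card H))"
proof -
  let ?l = "\<lambda>x. x <# H" and ?r = "\<lambda>x. H #> x"
  have fin': "finite (double_cosets G H)" using fin by (simp add: double_cosets_def)
  have Hpos: "card H > 0" using subgroup.finite_imp_card_positive[OF H fin] .
  have blk: "real (card (common_transversals ?l ?r D))
      = transversal_factor (card D div card H) * real (card H) ^ card (?r ` D)"
    if D: "D \<in> double_cosets G H" for D
  proof -
    obtain g where g: "g \<in> carrier G" "D = double_coset G H g"
      using D by (auto simp: double_cosets_def)
    define k m where "k = card D div card H" and "m = card (?l g \<inter> ?r g)"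
    note c = double_coset_counts[OF H fin g(1), folded g(2), folded k_def m_def]
    have "k > 0" using c(4) Hpos by (cases k) auto
    then show ?thesis
      unfolding k_def[symmetric] unfolding c(3) c(5) unfolding c(4)[symmetric]
      by (simp add: transversal_factor_def power_mult_distrib)
  qed
  have "card (DT G H) = (\<Prod>D\<in>double_cosets G H. card (common_transversals ?l ?r D))"
    using card_common_transversals_Union[OF _ fin' double_cosets_coset_sep[OF H]] fin
    by (simp add: Union_double_cosets[OF H] DT_eq_common_transversals[OF H])
  then have "real (card (DT G H)) =
      (\<Prod>D\<in>double_cosets G H. transversal_factor (card D div card H) * real (card H) ^ card (?r ` D))"
    by (simp only: of_nat_prod blk cong: prod.cong)
  also have "\<dots> = (\<Prod>D\<in>double_cosets G H. transversal_factor (card D div card H)) *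
      real (card H) ^ (\<Sum>D\<in>double_cosets G H. card (?r ` D))"
    by (simp add: prod.distrib power_sum)
  also have "(\<Sum>D\<in>double_cosets G H. card (?r ` D)) = card (rcosets H)"
  proof -
    have "rcosets H = ?r ` carrier G" by (auto simp: RCOSETS_def)
    also have "\<dots> = (\<Union>D\<in>double_cosets G H. ?r ` D)"
      using Union_double_cosets[OF H] by (metis image_Union)
    finally have "rcosets H = (\<Union>D\<in>double_cosets G H. ?r ` D)" .
    moreover have "card (\<Union>D\<in>double_cosets G H. ?r ` D) = (\<Sum>D\<in>double_cosets G H. card (?r ` D))"
    proof (rule card_UN_disjoint[OF fin'])
      show "\<forall>D\<in>double_cosets G H. finite (?r ` D)"
        using fin Union_double_cosets[OF H] by (metis Union_upper finite_imageI finite_subset)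
      show "\<forall>D\<in>double_cosets G H. \<forall>E\<in>double_cosets G H. D \<noteq> E \<longrightarrow> ?r ` D \<inter> ?r ` E = {}"
      proof (intro ballI impI, rule ccontr)
        fix D E assume DE: "D \<in> double_cosets G H" "E \<in> double_cosets G H" "D \<noteq> E"
          and "?r ` D \<inter> ?r ` E \<noteq> {}"
        then obtain x y where "x \<in> D" "y \<in> E" "?r x = ?r y" by auto
        then show False using double_cosets_coset_sep[OF H DE(1,2)] DE(3) by blast
      qed
    qed
    ultimately show ?thesis by simp
  qed
  finally show ?thesis using Hpos by (simp add: transversal_prob_def)
qed

end

section \<open>Passing to subgroups and quotients\<close>

lemma transversal_factor_pos: "transversal_factor k > 0"
  by (cases k) (auto simp: transversal_factor_def)

text \<open>Cancelling k+1 once turns (k+1)!/(k+1)^(k+1) into k!/(k+1)^k. At k = 0 both sides are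
  1.\<close>

lemma transversal_factor_Suc_le: "transversal_factor (Suc k) \<le> transversal_factor k"
proof -
  have "transversal_factor (Suc k) = fact k / real (Suc k) ^ k"
    by (simp add: transversal_factor_def divide_simps)
  also have "\<dots> \<le> fact k / real k ^ k"
    by (cases "k = 0") (auto intro!: divide_left_mono power_mono)
  finally show ?thesis by (simp add: transversal_factor_def)
qed

lemma transversal_factor_antimono: "j \<le> k \<Longrightarrow> transversal_factor k \<le> transversal_factor j"
  by (induction k rule: dec_induct) (auto intro: order_trans[OF transversal_factor_Suc_le])

lemma transversal_factor_le_1: "transversal_factor k \<le> 1"
  using transversal_factor_antimono[of 0 k] by (simp add: transversal_factor_def)

lemma transversal_factor_simps:
  "transversal_factor 1 = 1" "transversal_factor 2 = 1/2" "transversal_factor 3 = 2/9"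
  "transversal_factor 5 = 24/625"
  by (simp_all add: transversal_factor_def fact_numeral)

lemma prod_transversal_factor_subset:
  assumes "finite B" "A \<subseteq> B"
  shows "(\<Prod>D\<in>B. transversal_factor (f D)) \<le> (\<Prod>D\<in>A. transversal_factor (f D))"
proof -
  have "(\<Prod>D\<in>B. transversal_factor (f D)) =
      (\<Prod>D\<in>B - A. transversal_factor (f D)) * (\<Prod>D\<in>A. transversal_factor (f D))"
    using assms by (intro prod.subset_diff)
  moreover have "(\<Prod>D\<in>B - A. transversal_factor (f D)) \<le> 1"
    by (intro prod_le_1) (auto simp: transversal_factor_le_1 less_imp_le[OF transversal_factor_pos])
  moreover have "(\<Prod>D\<in>A. transversal_factor (f D)) \<ge> 0"
    by (intro prod_nonneg) (auto simp: less_imp_le[OF transversal_factor_pos])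
  ultimately show ?thesis by (simp add: mult_right_le_one_le mult_left_le_one_le prod_nonneg
        less_imp_le[OF transversal_factor_pos])
qed

lemma tp_le:
  assumes "finite (carrier G)" "subgroup H G"
  shows "tp G \<le> transversal_prob G H"
  unfolding tp_def using assms finite_transversal_probs[OF assms(1)] by (intro Min_le) auto

text \<open>The double cosets of H in U are among those in G, and the factors left out are at most
  1.\<close>

lemma (in group) transversal_prob_subgroup_mono:
  assumes fin: "finite (carrier G)" and U: "subgroup U G" and H: "subgroup H (G\<lparr>carrier := U\<rparr>)"
  shows "transversal_prob G H \<le> transversal_prob (G\<lparr>carrier := U\<rparr>) H"
proof -
  interpret U: group "G\<lparr>carrier := U\<rparr>" using subgroup.subgroup_is_group[OF U] is_group by simp
  have UG: "U \<subseteq> carrier G" using subgroup.subset[OF U] .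
  have HG: "subgroup H G" using incl_subgroup[OF U H] .
  have "double_cosets (G\<lparr>carrier := U\<rparr>) H \<subseteq> double_cosets G H"
    using UG by (auto simp: double_cosets_def double_coset_def)
  then show ?thesis
    unfolding transversal_prob_eq[OF HG fin]
    using U.transversal_prob_eq[OF H] finite_subset[OF UG fin] fin
    by (simp add: prod_transversal_factor_subset double_cosets_def)
qed

section \<open>Preimages under homomorphisms\<close>

context group_hom
begin

lemma card_fibre:
  assumes "x \<in> carrier G"
  shows "card {y \<in> carrier G. h y = h x} = card (kernel G H h)"
proof -
  have "{y \<in> carrier G. h y = h x} = kernel G H h #>\<^bsub>G\<^esub> x"
  proof (intro equalityI subsetI)
    fix y assume "y \<in> {y \<in> carrier G. h y = h x}"
    then have "y \<in> carrier G" "h (y \<otimes>\<^bsub>G\<^esub> inv\<^bsub>G\<^esub> x) = \<one>\<^bsub>H\<^esub>"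
      using assms by auto
    then show "y \<in> kernel G H h #>\<^bsub>G\<^esub> x"
      using assms G.mem_r_coset_iff[OF subgroup_kernel] by (simp add: kernel_def)
  next
    fix y assume "y \<in> kernel G H h #>\<^bsub>G\<^esub> x"
    then show "y \<in> {y \<in> carrier G. h y = h x}"
      using assms by (auto simp: r_coset_def kernel_def)
  qed
  then show ?thesis using G.card_r_coset[OF subgroup_kernel assms] by simp
qed

lemma card_preimage:
  assumes fin: "finite (carrier G)" and S: "S \<subseteq> h ` carrier G"
  shows "card {x \<in> carrier G. h x \<in> S} = card S * card (kernel G H h)"
proof -
  have "card {x \<in> carrier G. h x \<in> S} = card (h ` {x \<in> carrier G. h x \<in> S}) * card (kernel G H h)"
  proof (rule card_by_fibres)
    fix x assume x: "x \<in> {x \<in> carrier G. h x \<in> S}"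
    then have "{y \<in> {x \<in> carrier G. h x \<in> S}. h y = h x} = {y \<in> carrier G. h y = h x}" by auto
    then show "card {y \<in> {x \<in> carrier G. h x \<in> S}. h y = h x} = card (kernel G H h)"
      using card_fibre x by simp
  qed (use fin in simp)
  moreover have "h ` {x \<in> carrier G. h x \<in> S} = S" using S by auto
  ultimately show ?thesis by simp
qed

lemma subgroup_preimage:
  assumes "subgroup M H"
  shows "subgroup {x \<in> carrier G. h x \<in> M} G"
  using subgroup.one_closed[OF assms] subgroup.m_closed[OF assms] subgroup.m_inv_closed[OF assms]
  by (intro G.subgroupI) auto

lemma preimage_double_coset:
  assumes M: "subgroup M H" and surj: "h ` carrier G = carrier H" and g: "g \<in> carrier G"
  shows "{x \<in> carrier G. h x \<in> double_coset H M (h g)} =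
    double_coset G {x \<in> carrier G. h x \<in> M} g"
proof (intro equalityI subsetI)
  fix x assume "x \<in> {x \<in> carrier G. h x \<in> double_coset H M (h g)}"
  then obtain a b where x: "x \<in> carrier G" and ab: "a \<in> M" "b \<in> M" "h x = a \<otimes>\<^bsub>H\<^esub> h g \<otimes>\<^bsub>H\<^esub> b"
    by (auto simp: double_coset_def)
  have abc: "a \<in> carrier H" "b \<in> carrier H" using ab subgroup.mem_carrier[OF M] by auto
  then obtain b' where b': "b' \<in> carrier G" "h b' = b" using surj by (metis imageE)
  \<comment> \<open>Only the right factor b is lifted; the left factor is then forced by x, and its
    image is automatically a.\<close>
  let ?a = "x \<otimes>\<^bsub>G\<^esub> inv\<^bsub>G\<^esub> b' \<otimes>\<^bsub>G\<^esub> inv\<^bsub>G\<^esub> g"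
  have "h ?a = a"
    using x b' g ab abc by (simp add: H.m_assoc)
  moreover have "x = ?a \<otimes>\<^bsub>G\<^esub> g \<otimes>\<^bsub>G\<^esub> b'" using x b' g by (simp add: G.m_assoc)
  ultimately show "x \<in> double_coset G {x \<in> carrier G. h x \<in> M} g"
    using x b' g ab unfolding double_coset_def by (intro CollectI exI[of _ ?a] exI[of _ b']) simp
next
  fix x assume "x \<in> double_coset G {x \<in> carrier G. h x \<in> M} g"
  then show "x \<in> {x \<in> carrier G. h x \<in> double_coset H M (h g)}"
    using g by (auto simp: double_coset_def) blast
qed

text \<open>Preimages match the double cosets one to one and multiply the sizes of D and of M by the
  order of the kernel, so every ratio k is preserved.\<close>

lemma transversal_prob_preimage:
  assumes fin: "finite (carrier G)" and surj: "h ` carrier G = carrier H" and M: "subgroup M H"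
  shows "transversal_prob G {x \<in> carrier G. h x \<in> M} = transversal_prob H M"
proof -
  let ?P = "\<lambda>S. {x \<in> carrier G. h x \<in> S}"
  have finH: "finite (carrier H)" using fin surj by (metis finite_imageI)
  have MH: "M \<subseteq> carrier H" using subgroup.subset[OF M] .
  have dH: "D \<subseteq> carrier H" if "D \<in> double_cosets H M" for D
    using that H.Union_double_cosets[OF M] by (metis Union_upper)
  have img: "h ` ?P S = S" if "S \<subseteq> carrier H" for S using that surj by auto
  have dc: "double_cosets G (?P M) = ?P ` double_cosets H M"
  proof -
    have "double_cosets G (?P M) = (\<lambda>g. ?P (double_coset H M (h g))) ` carrier G"
      unfolding double_cosets_def using preimage_double_coset[OF M surj] by (intro image_cong) auto
    also have "\<dots> = ?P ` double_cosets H M"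
      unfolding double_cosets_def surj[symmetric] by (simp add: image_image)
    finally show ?thesis .
  qed
  have inj: "inj_on ?P (double_cosets H M)"
    using img[OF dH] by (metis (no_types, lifting) inj_onI)
  have kpos: "card (kernel G H h) > 0"
    using subgroup.finite_imp_card_positive[OF subgroup_kernel fin] .
  have crd: "card (?P S) = card S * card (kernel G H h)" if "S \<subseteq> carrier H" for S
    using that surj card_preimage[OF fin, of S] by simp
  have "transversal_prob G (?P M) =
      (\<Prod>D\<in>double_cosets H M. transversal_factor (card (?P D) div card (?P M)))"
    unfolding G.transversal_prob_eq[OF subgroup_preimage[OF M] fin] dc
    using inj by (simp add: prod.reindex)
  also have "\<dots> = (\<Prod>D\<in>double_cosets H M. transversal_factor (card D div card M))"
    using kpos by (intro prod.cong refl) (simp only: crd[OF dH] crd[OF MH] div_mult_mult2)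
  also have "\<dots> = transversal_prob H M" using H.transversal_prob_eq[OF M finH] by simp
  finally show ?thesis .
qed

end

text \<open>First isomorphism theorem: the section is U modulo the kernel of h.\<close>

lemma (in group) has_section_isoI:
  assumes U: "subgroup U G" and h: "group_hom (G\<lparr>carrier := U\<rparr>) K h" "h ` U = carrier K"
  shows "has_section_iso G K"
proof -
  interpret h: group_hom "G\<lparr>carrier := U\<rparr>" K h by fact
  show ?thesis
    unfolding has_section_iso_def
    using U h.normal_kernel h.FactGroup_iso h(2) by (metis partial_object.simps(1) partial_object.surjective
      partial_object.update_convs(1))
qed

text \<open>A subgroup of a section is a section: q followed by the inverse of f maps the q-preimage
  \<open>?V\<close> of the copy of K onto K.\<close>

lemma has_section_iso_of_embedding:
  assumes G: "group G" and U: "subgroup U G"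
    and q: "group_hom (G\<lparr>carrier := U\<rparr>) Q q" "q ` U = carrier Q"
    and f: "group_hom K Q f" "inj_on f (carrier K)"
  shows "has_section_iso G K"
proof -
  interpret G: group G by fact
  interpret q: group_hom "G\<lparr>carrier := U\<rparr>" Q q by fact
  interpret f: group_hom K Q f by fact
  let ?V = "{x \<in> carrier (G\<lparr>carrier := U\<rparr>). q x \<in> f ` carrier K}"
  let ?p = "\<lambda>x. inv_into (carrier K) f (q x)"
  have VU: "subgroup ?V (G\<lparr>carrier := U\<rparr>)" by (rule q.subgroup_preimage[OF f.img_is_subgroup])
  have V: "subgroup ?V G" using G.incl_subgroup[OF U VU] .
  have p: "?p x \<in> carrier K" "f (?p x) = q x" if "x \<in> ?V" for x
    using that by (auto simp: inv_into_into f_inv_into_f)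
  have "?p \<in> hom (G\<lparr>carrier := ?V\<rparr>) K"
  proof (rule homI)
    fix x y assume "x \<in> carrier (G\<lparr>carrier := ?V\<rparr>)" "y \<in> carrier (G\<lparr>carrier := ?V\<rparr>)"
    then have xy: "x \<in> ?V" "y \<in> ?V" by simp_all
    then have xyV: "x \<otimes>\<^bsub>G\<^esub> y \<in> ?V" using subgroup.m_closed[OF V] by blast
    have "f (?p (x \<otimes>\<^bsub>G\<^esub> y)) = q x \<otimes>\<^bsub>Q\<^esub> q y"
      using p(2)[OF xyV] q.hom_mult[of x y] xy by simp
    also have "\<dots> = f (?p x \<otimes>\<^bsub>K\<^esub> ?p y)" using p[OF xy(1)] p[OF xy(2)] by simp
    finally show "?p (x \<otimes>\<^bsub>G\<lparr>carrier := ?V\<rparr>\<^esub> y) = ?p x \<otimes>\<^bsub>K\<^esub> ?p y"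
      using inj_onD[OF f(2)] p(1) xy xyV f.m_closed by simp
  qed (use p in simp)
  then have "group_hom (G\<lparr>carrier := ?V\<rparr>) K ?p"
    using G.subgroup_imp_group[OF V] f.G.is_group by (simp add: group_hom_def group_hom_axioms_def)
  moreover have "?p ` ?V = carrier K"
  proof (intro equalityI subsetI)
    fix y assume y: "y \<in> carrier K"
    then obtain x where x: "x \<in> U" "q x = f y" using q(2) f.hom_closed by (metis imageE)
    then have "?p x = y" using y f(2) by simp
    then show "y \<in> ?p ` ?V" using x y by force
  qed (use p in auto)
  ultimately show ?thesis using G.has_section_isoI[OF V] by blast
qed

section \<open>A nilpotency criterion\<close>

definition comm :: "('a, 'b) monoid_scheme \<Rightarrow> 'a \<Rightarrow> 'a \<Rightarrow> 'a" where
  "comm G x y = x \<otimes>\<^bsub>G\<^esub> y \<otimes>\<^bsub>G\<^esub> inv\<^bsub>G\<^esub> x \<otimes>\<^bsub>G\<^esub> inv\<^bsub>G\<^esub> y"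

text \<open>The equation characterises \<open>w\<close> as the commutator of \<open>z\<close> and \<open>m\<close>; as it avoids inverses, the
  notion does not change when the carrier of \<open>G\<close> is restricted to a subgroup.\<close>

definition commutator_depth :: "('a, 'b) monoid_scheme \<Rightarrow> 'a set \<Rightarrow> ('a \<Rightarrow> nat) \<Rightarrow> bool" where
  "commutator_depth G M d \<longleftrightarrow> (\<forall>z\<in>M. \<forall>m\<in>M. \<forall>w\<in>M.
     w \<otimes>\<^bsub>G\<^esub> (m \<otimes>\<^bsub>G\<^esub> z) = z \<otimes>\<^bsub>G\<^esub> m \<longrightarrow> w = \<one>\<^bsub>G\<^esub> \<or> d w < d z)"

context group
begin

section \<open>Commutators modulo a normal subgroup\<close>

lemma comm_closed [simp]: "x \<in> carrier G \<Longrightarrow> y \<in> carrier G \<Longrightarrow> comm G x y \<in> carrier G"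
  by (simp add: comm_def)

lemma comm_mult:
  assumes "x \<in> carrier G" "y \<in> carrier G"
  shows "comm G x y \<otimes> (y \<otimes> x) = x \<otimes> y"
proof -
  have "comm G x y \<otimes> (y \<otimes> x) = x \<otimes> y \<otimes> (inv x \<otimes> ((inv y \<otimes> y) \<otimes> x))"
    unfolding comm_def using assms by (simp only: m_assoc inv_closed m_closed)
  then show ?thesis using assms by simp
qed

lemma inv_comm:
  assumes "x \<in> carrier G" "y \<in> carrier G"
  shows "inv (comm G x y) = comm G y x"
  using assms by (simp add: comm_def inv_mult_group m_assoc)

lemma comm_mem_sym:
  assumes K: "subgroup K G" and xy: "x \<in> carrier G" "y \<in> carrier G" and c: "comm G x y \<in> K"
  shows "comm G y x \<in> K"
  using subgroup.m_inv_closed[OF K c] inv_comm[OF xy] by simp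

lemma comm_mem_left:
  assumes A: "A \<lhd> G" and x: "x \<in> A" and y: "y \<in> carrier G"
  shows "comm G x y \<in> A"
proof -
  have sA: "subgroup A G" using A normal_imp_subgroup by blast
  have xc: "x \<in> carrier G" using subgroup.mem_carrier[OF sA x] .
  have "y \<otimes> inv x \<otimes> inv y \<in> A"
    using normal_invE(2)[OF A y subgroup.m_inv_closed[OF sA x]] .
  then have "x \<otimes> (y \<otimes> inv x \<otimes> inv y) \<in> A" by (rule subgroup.m_closed[OF sA x])
  then show ?thesis using xc y by (simp add: comm_def m_assoc)
qed

lemma comm_mem_right:
  assumes "A \<lhd> G" "x \<in> carrier G" "y \<in> A"
  shows "comm G x y \<in> A"
  using comm_mem_sym[of A y x] comm_mem_left[OF assms(1,3,2)] assms normal_imp_subgroup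
    subgroup.mem_carrier by metis

text \<open>These are the elements commuting with S modulo K. Closure follows from [ab,s] =
  a[b,s]a^-1 [a,s] and [a^-1,s] = a^-1 [s,a] a, as K is normal.\<close>

lemma subgroup_comm_mem:
  assumes K: "K \<lhd> G" and S: "S \<subseteq> carrier G"
  shows "subgroup {a \<in> carrier G. \<forall>s\<in>S. comm G a s \<in> K} G"
proof -
  interpret K: normal K G by fact
  show ?thesis
  proof (rule subgroupI)
    show "{a \<in> carrier G. \<forall>s\<in>S. comm G a s \<in> K} \<noteq> {}"
      using S subgroup.one_closed[OF K.subgroup_axioms] by (force simp: comm_def subset_iff)
  next
    fix a assume a: "a \<in> {a \<in> carrier G. \<forall>s\<in>S. comm G a s \<in> K}"
    have "comm G (inv a) s \<in> K" if s: "s \<in> S" for s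
    proof -
      have ac: "a \<in> carrier G" and sc: "s \<in> carrier G" using a s S by auto
      have "comm G s a \<in> K" using a s comm_mem_sym[OF K.subgroup_axioms ac sc] by auto
      then have "inv a \<otimes> comm G s a \<otimes> inv (inv a) \<in> K"
        using normal_invE(2)[OF K, of "inv a"] ac by simp
      moreover have "inv a \<otimes> comm G s a \<otimes> inv (inv a) = comm G (inv a) s"
        using ac sc by (simp add: comm_def m_assoc)
      ultimately show ?thesis by simp
    qed
    then show "inv a \<in> {a \<in> carrier G. \<forall>s\<in>S. comm G a s \<in> K}" using a by simp
  next
    fix a b assume ab: "a \<in> {a \<in> carrier G. \<forall>s\<in>S. comm G a s \<in> K}"
      "b \<in> {a \<in> carrier G. \<forall>s\<in>S. comm G a s \<in> K}"
    have "comm G (a \<otimes> b) s \<in> K" if s: "s \<in> S" for s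
    proof -
      have c: "a \<in> carrier G" "b \<in> carrier G" "s \<in> carrier G" using ab s S by auto
      have "(a \<otimes> comm G b s \<otimes> inv a) \<otimes> comm G a s \<in> K"
        using ab s normal_invE(2)[OF K c(1)] K.m_closed by auto
      moreover have "(a \<otimes> comm G b s \<otimes> inv a) \<otimes> comm G a s
          = (a \<otimes> b \<otimes> s \<otimes> inv b) \<otimes> (inv s \<otimes> ((inv a \<otimes> a) \<otimes> s)) \<otimes> inv a \<otimes> inv s"
        unfolding comm_def using c by (simp only: m_assoc inv_closed m_closed)
      moreover have "\<dots> = comm G (a \<otimes> b) s"
        using c by (simp add: comm_def m_assoc inv_mult_group)
      ultimately show ?thesis by simp
    qed
    then show "a \<otimes> b \<in> {a \<in> carrier G. \<forall>s\<in>S. comm G a s \<in> K}" using ab by simp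
  qed simp
qed

text \<open>For normal S this rests on [g a g^-1, s] = g [a, g^-1 s g] g^-1.\<close>

lemma normal_comm_mem:
  assumes K: "K \<lhd> G" and S: "S \<lhd> G"
  shows "{a \<in> carrier G. \<forall>s\<in>S. comm G a s \<in> K} \<lhd> G"
proof -
  have sS: "subgroup S G" using S normal_imp_subgroup by blast
  have SG: "S \<subseteq> carrier G" using subgroup.subset[OF sS] .
  have "comm G (g \<otimes> a \<otimes> inv g) s \<in> K"
    if g: "g \<in> carrier G" and a: "a \<in> carrier G" "\<forall>s\<in>S. comm G a s \<in> K" and s: "s \<in> S" for g a s
  proof -
    have sc: "s \<in> carrier G" using s SG by auto
    let ?s = "inv g \<otimes> s \<otimes> g"
    have "?s \<in> S" using normal_invE(2)[OF S, of "inv g" s] g s by simp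
    then have "g \<otimes> comm G a ?s \<otimes> inv g \<in> K" using a normal_invE(2)[OF K g] by simp
    moreover have "g \<otimes> comm G a ?s \<otimes> inv g = g \<otimes> a \<otimes> inv g \<otimes> s \<otimes> (g \<otimes> inv a \<otimes> inv g) \<otimes> inv s"
      using g a sc by (simp add: comm_def m_assoc inv_mult_group)
    moreover have "\<dots> = comm G (g \<otimes> a \<otimes> inv g) s"
      using g a sc by (simp add: comm_def m_assoc inv_mult_group)
    ultimately show ?thesis by simp
  qed
  then show ?thesis unfolding normal_inv_iff using subgroup_comm_mem[OF K SG] by simp
qed

lemma commutator_depth_comm:
  assumes d: "commutator_depth G M d" and M: "subgroup M G" and zm: "z \<in> M" "m \<in> M"
  shows "comm G z m = \<one> \<or> d (comm G z m) < d z"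
proof -
  have "comm G z m \<in> M"
    unfolding comm_def using zm subgroup.m_closed[OF M] subgroup.m_inv_closed[OF M] by simp
  then show ?thesis
    using d zm comm_mult[of z m] subgroup.mem_carrier[OF M] unfolding commutator_depth_def by blast
qed

text \<open>Take a of least depth in A - K. Each [a,m] stays in A and is trivial or of smaller
  depth, hence lies in K.\<close>

lemma ex_central_mod:
  assumes d: "commutator_depth G M d" and M: "subgroup M G" and K: "subgroup K G"
    and A: "A \<subseteq> M" "\<And>a m. a \<in> A \<Longrightarrow> m \<in> M \<Longrightarrow> comm G a m \<in> A" and AK: "\<not> A \<subseteq> K"
  shows "\<exists>a\<in>A - K. \<forall>m\<in>M. comm G a m \<in> K"
proof -
  obtain a where a: "a \<in> A - K" "\<And>b. b \<in> A - K \<Longrightarrow> d a \<le> d b"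
    using ex_has_least_nat[of "\<lambda>x. x \<in> A - K" _ d] AK by blast
  have "comm G a m \<in> K" if m: "m \<in> M" for m
    using commutator_depth_comm[OF d M, of a m] a(1) a(2)[of "comm G a m"] A m
      subgroup.one_closed[OF K] by (metis DiffD1 DiffI leD subsetD)
  then show ?thesis using a by blast
qed

text \<open>The core of Fitting's theorem: if two normal subgroups with a depth function generate G,
  every proper normal quotient of G has a nontrivial centre. If M lies in K, an element of N - K
  that N centralises modulo K will do, since its commutators with M lie in M.\<close>

lemma ex_central_mod_join:
  assumes M: "M \<lhd> G" "commutator_depth G M d" and N: "N \<lhd> G" "commutator_depth G N e"
    and join: "\<And>S. subgroup S G \<Longrightarrow> M \<subseteq> S \<Longrightarrow> N \<subseteq> S \<Longrightarrow> S = carrier G"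
    and K: "K \<lhd> G" "K \<noteq> carrier G"
  shows "\<exists>z\<in>carrier G - K. \<forall>g\<in>carrier G. comm G z g \<in> K"
proof -
  have s: "subgroup M G" "subgroup N G" "subgroup K G"
    using M N K normal_imp_subgroup by blast+
  have MG: "M \<subseteq> carrier G" "N \<subseteq> carrier G" using s subgroup.subset by blast+
  \<comment> \<open>It suffices to commute modulo K with M and with N, because the elements
    commuting with z modulo K form a subgroup.\<close>
  have fin: ?thesis
    if z: "z \<in> carrier G - K" and zM: "\<And>m. m \<in> M \<Longrightarrow> comm G z m \<in> K"
      and zN: "\<And>m. m \<in> N \<Longrightarrow> comm G z m \<in> K" for z
  proof -
    let ?C = "{a \<in> carrier G. \<forall>s\<in>{z}. comm G a s \<in> K}"
    have "?C = carrier G"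
    proof (rule join)
      show "subgroup ?C G" using z by (intro subgroup_comm_mem[OF K(1)]) simp
      show "M \<subseteq> ?C" using z zM MG(1) comm_mem_sym[OF s(3), of z] by (simp add: subset_iff)
      show "N \<subseteq> ?C" using z zN MG(2) comm_mem_sym[OF s(3), of z] by (simp add: subset_iff)
    qed
    then have "\<forall>g\<in>carrier G. comm G z g \<in> K" using z comm_mem_sym[OF s(3)] by blast
    then show ?thesis using z by blast
  qed
  show ?thesis
  proof (cases "M \<subseteq> K")
    case True
    then have "\<not> N \<subseteq> K" using join[OF s(3)] K(2) by blast
    then obtain a where a: "a \<in> N - K" "\<forall>n\<in>N. comm G a n \<in> K"
      using ex_central_mod[OF N(2) s(2,3), of N] comm_mem_left[OF N(1)] MG(2) by blast
    show ?thesis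
      using fin[of a] a comm_mem_right[OF M(1), of a] True MG(2) by blast
  next
    case False
    \<comment> \<open>The elements of M that M centralises modulo K. This set is normal in G, so
      commutators of its elements with N lie both in \<open>?A\<close> and in N.\<close>
    let ?A = "M \<inter> {a \<in> carrier G. \<forall>s\<in>M. comm G a s \<in> K}"
    have A: "?A \<lhd> G" by (rule normal_subgroup_intersect[OF M(1) normal_comm_mem[OF K(1) M(1)]])
    obtain a where a: "a \<in> M - K" "\<forall>m\<in>M. comm G a m \<in> K"
      using ex_central_mod[OF M(2) s(1,3), of M] comm_mem_left[OF M(1)] MG(1) False by blast
    show ?thesis
    \<comment> \<open>If the intersection lies in K, the element a already commutes with N modulo K.
      Otherwise N is made to act on the intersection: the element found there is central modulo K
      for N by construction and for M because it belongs to \<open>?A\<close>.\<close>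
    proof (cases "?A \<inter> N \<subseteq> K")
      case True
      have "comm G a n \<in> ?A \<inter> N" if n: "n \<in> N" for n
      proof
        have ac: "a \<in> carrier G" "n \<in> carrier G" using a n MG by auto
        then show "comm G a n \<in> ?A" using comm_mem_left[OF A, of a n] a by simp
        show "comm G a n \<in> N" using comm_mem_right[OF N(1) ac(1) n] .
      qed
      then have "comm G a n \<in> K" if "n \<in> N" for n using that True by (meson subsetD)
      then show ?thesis using fin[of a] a MG(1) by auto
    next
      case False
      have "\<exists>z\<in>?A \<inter> N - K. \<forall>n\<in>N. comm G z n \<in> K"
      proof (rule ex_central_mod[OF N(2) s(2,3) _ _ False])
        fix b n assume bn: "b \<in> ?A \<inter> N" "n \<in> N"
        then have nc: "b \<in> carrier G" "n \<in> carrier G" using MG by auto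
        show "comm G b n \<in> ?A \<inter> N"
          using comm_mem_left[OF A IntD1[OF bn(1)] nc(2)] comm_mem_right[OF N(1) nc(1) bn(2)]
          by (rule IntI)
      qed simp
      then obtain z where "z \<in> ?A \<inter> N - K" "\<forall>n\<in>N. comm G z n \<in> K" by (rule bexE)
      then show ?thesis using fin[of z] by simp
    qed
  qed
qed

text \<open>The upper central series, written with commutators instead of centres of quotient
  groups.\<close>

primrec upper_series :: "nat \<Rightarrow> 'a set" where
  "upper_series 0 = {\<one>}"
| "upper_series (Suc n) = {z \<in> carrier G. \<forall>g\<in>carrier G. comm G z g \<in> upper_series n}"

lemma upper_series_normal: "upper_series n \<lhd> G"
proof (induction n)
  case (Suc n)
  have "carrier G \<lhd> G" by (simp add: normal_inv_iff subgroup_self)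
  then show ?case using normal_comm_mem[OF Suc] by simp
qed (simp add: one_is_normal)

lemma upper_series_mono: "upper_series n \<subseteq> upper_series (Suc n)"
  using comm_mem_left[OF upper_series_normal] upper_series_normal[of n] normal_imp_subgroup
    subgroup.subset by fastforce

text \<open>As long as the series has not reached G, hypothesis \<open>c\<close> makes it grow
  strictly, so its n-th term would have at least n elements.\<close>

lemma upper_series_reaches:
  assumes fin: "finite (carrier G)"
    and c: "\<And>K. K \<lhd> G \<Longrightarrow> K \<noteq> carrier G \<Longrightarrow> \<exists>z\<in>carrier G - K. \<forall>g\<in>carrier G. comm G z g \<in> K"
  shows "\<exists>n. upper_series n = carrier G"
proof (rule ccontr)
  assume no: "\<nexists>n. upper_series n = carrier G"
  have sub: "upper_series n \<subseteq> carrier G" for n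
    by (rule subgroup.subset[OF normal_imp_subgroup[OF upper_series_normal]])
  have "card (upper_series n) \<ge> n" for n
  proof (induction n)
    case (Suc n)
    obtain z where "z \<in> carrier G - upper_series n" "\<forall>g\<in>carrier G. comm G z g \<in> upper_series n"
      using c[OF upper_series_normal, of n] no by metis
    then have "upper_series n \<subset> upper_series (Suc n)" using upper_series_mono[of n] by auto
    then have "card (upper_series n) < card (upper_series (Suc n))"
      using finite_subset[OF sub fin] by (intro psubset_card_mono)
    then show ?case using Suc by simp
  qed simp
  moreover have "card (upper_series n) \<le> card (carrier G)" for n using sub fin card_mono by blast
  ultimately show False by (metis not_less_eq_eq order_trans)
qed

text \<open>The depth of z is the first term containing z; a commutator with z already lies in the
  term before.\<close>

lemma upper_series_depth:
  assumes n: "upper_series n = carrier G"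
  shows "commutator_depth G (carrier G) (\<lambda>z. LEAST i. z \<in> upper_series i)"
  unfolding commutator_depth_def
proof (intro ballI impI)
  let ?d = "\<lambda>z. LEAST i. z \<in> upper_series i"
  fix z m w assume zmw: "z \<in> carrier G" "m \<in> carrier G" "w \<in> carrier G" "w \<otimes> (m \<otimes> z) = z \<otimes> m"
  have w: "w = comm G z m"
  proof -
    have "w \<otimes> (m \<otimes> z) = comm G z m \<otimes> (m \<otimes> z)" using comm_mult[of z m] zmw by simp
    then show ?thesis using zmw right_cancel[of "m \<otimes> z" w "comm G z m"] by simp
  qed
  have zd: "z \<in> upper_series (?d z)" using zmw(1) n by (metis LeastI)
  show "w = \<one> \<or> ?d w < ?d z"
  proof (cases "?d z")
    case 0
    then have "z = \<one>" using zd by simp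
    then show ?thesis using w zmw by (simp add: comm_def)
  next
    case (Suc i)
    then have "w \<in> upper_series i" using zd w zmw by simp
    then have "?d w \<le> i" by (rule Least_le)
    then show ?thesis using Suc by simp
  qed
qed

text \<open>\<open>ex_central_mod\<close> drives the upper series up to G, say at n. Then the i-th
  lower term lies in the upper term n - i, since taking commutators with G moves down one step in
  both series.\<close>

lemma nilpotent_of_commutator_depth:
  assumes fin: "finite (carrier G)" and d: "commutator_depth G (carrier G) d"
  shows "nilpotent_group G"
proof -
  have "\<exists>z\<in>carrier G - K. \<forall>g\<in>carrier G. comm G z g \<in> K" if K: "K \<lhd> G" "K \<noteq> carrier G" for K
  proof (rule ex_central_mod[OF d subgroup_self])
    show "subgroup K G" using K normal_imp_subgroup by blast
    then show "\<not> carrier G \<subseteq> K" using K(2) subgroup.subset[of K G] by auto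
  qed auto
  then obtain n where n: "upper_series n = carrier G" using upper_series_reaches[OF fin] by blast
  have sub: "lower_central_series G i \<subseteq> upper_series (n - i)" if "i \<le> n" for i
    using that
  proof (induction i)
    case (Suc i)
    have "{x \<otimes> y \<otimes> inv x \<otimes> inv y | x y. x \<in> lower_central_series G i \<and> y \<in> carrier G}
        \<subseteq> upper_series (n - Suc i)"
    proof
      fix c assume "c \<in> {x \<otimes> y \<otimes> inv x \<otimes> inv y | x y. x \<in> lower_central_series G i \<and> y \<in> carrier G}"
      then obtain x y where xy: "x \<in> lower_central_series G i" "y \<in> carrier G" "c = comm G x y"
        by (auto simp: comm_def)
      moreover have "n - i = Suc (n - Suc i)" using Suc.prems by simp
      ultimately have "x \<in> upper_series (Suc (n - Suc i))" using Suc by auto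
      then show "c \<in> upper_series (n - Suc i)" using xy by simp
    qed
    then show ?case
      using generate_subgroup_incl[OF _ normal_imp_subgroup[OF upper_series_normal]] by simp
  qed (use n in simp)
  have "\<one> \<in> lower_central_series G n"
    by (cases n) (auto intro: generate.one)
  then have "lower_central_series G n = {\<one>}" using sub[of n] by auto
  then show ?thesis using is_group by (auto simp: nilpotent_group_def)
qed

end

section \<open>Maximal subgroups and the induction over subgroups\<close>

definition maximal_in :: "('a, 'b) monoid_scheme \<Rightarrow> 'a set \<Rightarrow> 'a set \<Rightarrow> bool" where
  "maximal_in G M U \<longleftrightarrow> subgroup M G \<and> M \<subset> U \<and>
     (\<forall>S. subgroup S G \<longrightarrow> M \<subseteq> S \<longrightarrow> S \<subseteq> U \<longrightarrow> S = M \<or> S = U)"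

lemma (in group) ex_maximal_in:
  assumes fin: "finite U" and S: "subgroup S G" "S \<subset> U"
  shows "\<exists>M. maximal_in G M U \<and> S \<subseteq> M"
proof -
  let ?P = "\<lambda>M. subgroup M G \<and> S \<subseteq> M \<and> M \<subset> U"
  have "\<forall>T. ?P T \<longrightarrow> card T < Suc (card U)" using fin by (auto intro: card_mono less_Suc_eq_le[THEN iffD2])
  then have "\<exists>M. ?P M \<and> (\<forall>T. ?P T \<longrightarrow> card T \<le> card M)"
    using S ex_has_greatest_nat[of ?P S card "Suc (card U)"] by blast
  then obtain M where M: "?P M" "\<And>T. ?P T \<Longrightarrow> card T \<le> card M" by blast
  have "T = M" if T: "subgroup T G" "M \<subseteq> T" "T \<subseteq> U" "T \<noteq> U" for T
  proof -
    have "?P T" using T M(1) by blast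
    then have "card T \<le> card M" by (rule M(2))
    then show ?thesis using T fin by (metis card_seteq finite_subset)
  qed
  then show ?thesis using M(1) unfolding maximal_in_def by blast
qed

text \<open>Induction on the order of U. Two different maximal subgroups of U have depth functions
  by induction and together generate U, so the join argument applies. With at most one maximal
  subgroup, U is cyclic.\<close>

theorem (in group) nilpotent_of_maximal_normal:
  assumes fin: "finite (carrier G)"
    and nrm: "\<And>U M. subgroup U G \<Longrightarrow> maximal_in G M U \<Longrightarrow> M \<lhd> G\<lparr>carrier := U\<rparr>"
  shows "nilpotent_group G"
proof -
  have "\<exists>d. commutator_depth G U d" if "subgroup U G" for U
    using that
  proof (induction "card U" arbitrary: U rule: less_induct)
    case less
    have UG: "U \<subseteq> carrier G" using subgroup.subset[OF less.prems] .
    have finU: "finite U" using finite_subset[OF UG fin] .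
    interpret U: group "G\<lparr>carrier := U\<rparr>" using subgroup_imp_group[OF less.prems] .
    have IH: "\<exists>d. commutator_depth G M d" if "maximal_in G M U" for M
      using that less.hyps[OF psubset_card_mono[OF finU]] by (simp add: maximal_in_def)
    show ?case
    proof (cases "\<exists>M N. maximal_in G M U \<and> maximal_in G N U \<and> M \<noteq> N")
      case True
      then obtain M N where MN: "maximal_in G M U" "maximal_in G N U" "M \<noteq> N" by blast
      obtain d e where de: "commutator_depth G M d" "commutator_depth G N e"
        using IH[OF MN(1)] IH[OF MN(2)] by (elim exE)
      have "\<exists>n. U.upper_series n = carrier (G\<lparr>carrier := U\<rparr>)"
      proof (rule U.upper_series_reaches)
        fix K assume K: "K \<lhd> G\<lparr>carrier := U\<rparr>" "K \<noteq> carrier (G\<lparr>carrier := U\<rparr>)"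
        have de': "commutator_depth (G\<lparr>carrier := U\<rparr>) M d" "commutator_depth (G\<lparr>carrier := U\<rparr>) N e"
          using de by (simp_all add: commutator_depth_def)
        show "\<exists>z\<in>carrier (G\<lparr>carrier := U\<rparr>) - K.
            \<forall>g\<in>carrier (G\<lparr>carrier := U\<rparr>). comm (G\<lparr>carrier := U\<rparr>) z g \<in> K"
        proof (rule U.ex_central_mod_join[OF nrm[OF less.prems MN(1)] de'(1)
              nrm[OF less.prems MN(2)] de'(2) _ K])
          fix S assume S: "subgroup S (G\<lparr>carrier := U\<rparr>)" "M \<subseteq> S" "N \<subseteq> S"
          then have "subgroup S G" "S \<subseteq> U"
            using incl_subgroup[OF less.prems S(1)] subgroup.subset[OF S(1)] by auto
          then show "S = carrier (G\<lparr>carrier := U\<rparr>)"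
            using MN S(2,3) unfolding maximal_in_def by auto
        qed
      qed (use finU in simp)
      then obtain n where "U.upper_series n = carrier (G\<lparr>carrier := U\<rparr>)" ..
      from U.upper_series_depth[OF this]
      have "commutator_depth G U (\<lambda>z. LEAST i. z \<in> U.upper_series i)"
        by (simp add: commutator_depth_def)
      then show ?thesis by (intro exI)
    next
      case False
      \<comment> \<open>Otherwise each element generates a proper subgroup and so lies in a maximal
        one. These all coincide, and a proper subgroup would contain all of U.\<close>
      have "\<exists>x\<in>U. generate G {x} = U"
      proof (rule ccontr)
        assume no: "\<not> (\<exists>x\<in>U. generate G {x} = U)"
        have mx: "\<exists>M. maximal_in G M U \<and> x \<in> M" if x: "x \<in> U" for x
        proof -
          have "subgroup (generate G {x}) G" "generate G {x} \<subseteq> U"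
            using x UG generate_is_subgroup generate_subgroup_incl[OF _ less.prems] by auto
          then show ?thesis
            using ex_maximal_in[OF finU, of "generate G {x}"] no x generate.incl[of x "{x}" G]
            by (metis psubsetI singletonI subsetD)
        qed
        then obtain M where M: "maximal_in G M U" using subgroup.one_closed[OF less.prems] by blast
        then obtain x where "x \<in> U" "x \<notin> M" unfolding maximal_in_def by blast
        then show False using mx M False by blast
      qed
      then obtain x where x: "x \<in> U" "generate G {x} = U" by blast
      have xc: "x \<in> carrier G" using x UG by blast
      have U_eq: "U = {x [^] (k :: int) | k. k \<in> UNIV}" using generate_pow[OF xc] x(2) by simp
      have ab: "z \<otimes> m = m \<otimes> z" if zm: "z \<in> U" "m \<in> U" for z m
      proof -
        obtain i j :: int where "z = x [^] i" "m = x [^] j" using zm U_eq by blast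
        then show ?thesis using xc by (simp add: int_pow_mult[symmetric] add.commute)
      qed
      \<comment> \<open>In an abelian group all commutators are trivial, so any depth function will
        do.\<close>
      have "commutator_depth G U (\<lambda>_. 0)"
        unfolding commutator_depth_def
      proof (intro ballI impI disjI1)
        fix z m w assume zmw: "z \<in> U" "m \<in> U" "w \<in> U" "w \<otimes> (m \<otimes> z) = z \<otimes> m"
        then have c: "z \<in> carrier G" "m \<in> carrier G" "w \<in> carrier G" using UG by auto
        have "w \<otimes> (m \<otimes> z) = m \<otimes> z" using zmw(4) ab[OF zmw(1,2)] by simp
        then show "w = \<one>" using c by (simp add: l_cancel_one)
      qed
      then show ?thesis by (intro exI)
    qed
  qed
  then show ?thesis using nilpotent_of_commutator_depth[OF fin] subgroup_self by blast
qed

section \<open>Recognising dihedral and alternating groups\<close>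

definition embeds :: "('a, 'b) monoid_scheme \<Rightarrow> ('c, 'd) monoid_scheme \<Rightarrow> bool" where
  "embeds K Q \<longleftrightarrow> (\<exists>f. group_hom K Q f \<and> inj_on f (carrier K))"

context group
begin

lemma involution_conj_pow:
  assumes t: "t \<in> carrier G" and r: "r \<in> carrier G"
    and trt: "t \<otimes> r = inv r \<otimes> t"
  shows "t \<otimes> r [^] (k::nat) = inv (r [^] k) \<otimes> t"
proof (induction k)
  case 0
  show ?case using t by simp
next
  case (Suc k)
  have "t \<otimes> r [^] Suc k = (t \<otimes> r [^] k) \<otimes> r" using t r by (simp add: m_assoc)
  also have "\<dots> = inv (r [^] k) \<otimes> (t \<otimes> r)" using Suc t r by (simp add: m_assoc)
  also have "\<dots> = (inv (r [^] k) \<otimes> inv r) \<otimes> t" using t r trt by (simp add: m_assoc)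
  also have "inv (r [^] k) \<otimes> inv r = inv (r \<otimes> r [^] k)" using r by (simp add: inv_mult_group)
  also have "r \<otimes> r [^] k = r [^] Suc k" using nat_pow_Suc2[OF r, of k] by simp
  finally show ?case .
qed

text \<open>The map sends (i, s) to r^i or r^i t. It is injective because t is no power of r. That t
  and r lie in the image serves to show later that the image is the whole group.\<close>

lemma dihedral_embedding:
  assumes t: "t \<in> carrier G" "t \<otimes> t = \<one>" and r: "r \<in> carrier G" and n: "ord r = n" "n > 0"
    and trt: "t \<otimes> r = inv r \<otimes> t" and nt: "t \<notin> generate G {r}"
  shows "\<exists>f. group_hom (dihedral_group n) G f \<and> inj_on f (carrier (dihedral_group n)) \<and>
    t \<in> f ` carrier (dihedral_group n) \<and> r \<in> f ` carrier (dihedral_group n)"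
proof -
  let ?D = "dihedral_group n"
  define f :: "int \<times> bool \<Rightarrow> 'a" where "f = (\<lambda>(i, s). r [^] i \<otimes> (if s then t else \<one>))"
  have modn: "r [^] (a mod int n) = r [^] a" for a :: int
    using int_pow_eq[OF r, of "a mod int n" a] n(1)
    by (simp add: dvd_minus_mod minus_mod_eq_mult_div)
  have swap: "t \<otimes> r [^] j = r [^] (- j) \<otimes> t" if j: "j \<ge> 0" for j :: int
  proof -
    have "r [^] j = r [^] nat j" using j int_pow_int[of G r "nat j"] by simp
    then show ?thesis using involution_conj_pow[OF t(1) r trt, of "nat j"] r by (simp add: int_pow_neg)
  qed
  have fh: "f \<in> hom ?D G"
  proof (rule homI)
    fix x assume "x \<in> carrier ?D"
    then show "f x \<in> carrier G" using t r by (auto simp: f_def split: prod.splits)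
  next
    fix x y assume "x \<in> carrier ?D" "y \<in> carrier ?D"
    then obtain i s j u where xy: "x = (i, s)" "y = (j, u)" "j \<ge> 0"
      by (auto simp: dihedral_group_def)
    show "f (x \<otimes>\<^bsub>?D\<^esub> y) = f x \<otimes> f y"
    proof (cases s)
      case False
      then show ?thesis using xy t r
        by (cases u) (simp_all add: f_def dihedral_group_def modn int_pow_mult m_assoc)
    next
      case True
      have "f x \<otimes> f y = r [^] i \<otimes> (t \<otimes> r [^] j) \<otimes> (if u then t else \<one>)"
        using xy True t r by (simp add: f_def m_assoc)
      also have "\<dots> = r [^] i \<otimes> r [^] (- j) \<otimes> (t \<otimes> (if u then t else \<one>))"
        unfolding swap[OF xy(3)] using t r by (simp add: m_assoc)
      also have "\<dots> = r [^] (i - j) \<otimes> (t \<otimes> (if u then t else \<one>))"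
        using r by (simp add: int_pow_mult[symmetric])
      also have "\<dots> = f (x \<otimes>\<^bsub>?D\<^esub> y)"
        using xy True t r by (simp add: f_def dihedral_group_def modn)
      finally show ?thesis by simp
    qed
  qed
  interpret f: group_hom ?D G f
    using fh dihedral_group_is_group[OF n(2)] is_group by (simp add: group_hom_def group_hom_axioms_def)
  have gen: "r [^] i \<in> generate G {r}" for i :: int
    using generate_pow[OF r] by blast
  have "x = \<one>\<^bsub>?D\<^esub>" if x: "x \<in> carrier ?D" "f x = \<one>" for x
  proof -
    obtain i s where xi: "x = (i, s)" "0 \<le> i" "i < int n" using x(1) by (auto simp: dihedral_group_def)
    show ?thesis
    proof (cases s)
      case True
      then have "r [^] i \<otimes> t = \<one>" using x xi by (simp add: f_def)
      then have "t = inv (r [^] i)" using t r by (metis inv_equality int_pow_closed inv_inv)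
      then have "t = r [^] (- i)" using r by (simp add: int_pow_neg)
      then show ?thesis using nt gen by simp
    next
      case False
      then have "r [^] i = \<one>" using x xi r by (simp add: f_def)
      then have "int n dvd i" using int_pow_eq_id[OF r] n by simp
      then have "i = 0" using xi zdvd_not_zless[of i "int n"] by (cases "i = 0") auto
      then show ?thesis using xi False by (simp add: dihedral_group_def)
    qed
  qed
  then have "inj_on f (carrier ?D)" using f.inj_on_one_iff by blast
  moreover have "t = f (0, True)" using t by (simp add: f_def)
  \<comment> \<open>The exponent of r is \<open>1 mod int n\<close>, since for n = 1 the only
    exponent in the carrier is 0.\<close>
  moreover have "(0, True) \<in> carrier ?D" "(1 mod int n, False) \<in> carrier ?D"
    using n by (auto simp: dihedral_group_def)
  moreover have "r = f (1 mod int n, False)" using r modn[of 1] by (simp add: f_def)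
  ultimately show ?thesis using f.group_hom_axioms by (metis image_eqI)
qed

section \<open>Subgroups of index two and normalisers\<close>

lemma index_two_cosets:
  assumes fin: "finite (carrier G)" and I: "subgroup I G" and c: "2 * card I = card (carrier G)"
    and x: "x \<in> carrier G" "x \<notin> I"
  shows "x <# I = carrier G - I" "I #> x = carrier G - I"
proof -
  have IG: "I \<subseteq> carrier G" using subgroup.subset[OF I] .
  have cd: "card (carrier G - I) = card I" using c IG fin by (simp add: card_Diff_subset finite_subset)
  have "x <# I \<subseteq> carrier G - I"
  proof
    fix y assume "y \<in> x <# I"
    then obtain i where i: "i \<in> I" "y = x \<otimes> i" by (auto simp: l_coset_def)
    then show "y \<in> carrier G - I"
      using x IG subgroup_mult_right_iff[OF I i(1) x(1)] by auto
  qed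
  then show "x <# I = carrier G - I"
    using card_l_coset[OF I x(1)] cd fin by (intro card_subset_eq) auto
  have "I #> x \<subseteq> carrier G - I"
  proof
    fix y assume "y \<in> I #> x"
    then obtain i where i: "i \<in> I" "y = i \<otimes> x" by (auto simp: r_coset_def)
    then show "y \<in> carrier G - I"
      using x IG subgroup_mult_left_iff[OF I i(1) x(1)] by auto
  qed
  then show "I #> x = carrier G - I"
    using card_r_coset[OF I x(1)] cd fin by (intro card_subset_eq) auto
qed

lemma index_two_coset_eq:
  assumes fin: "finite (carrier G)" and I: "subgroup I G" and c: "2 * card I = card (carrier G)"
    and x: "x \<in> carrier G"
  shows "x <# I = I #> x"
proof (cases "x \<in> I")
  case True
  then show ?thesis using I coset_join2[OF x I] coset_join3[OF x I] by simp
qed (use index_two_cosets[OF fin I c x] in simp)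

text \<open>If both x and its square lay outside I, the square would lie in xI, the only coset left,
  and cancelling x would put x into I.\<close>

lemma index_two_square_mem:
  assumes fin: "finite (carrier G)" and I: "subgroup I G" and c: "2 * card I = card (carrier G)"
    and x: "x \<in> carrier G"
  shows "x \<otimes> x \<in> I"
proof (rule ccontr)
  assume n: "x \<otimes> x \<notin> I"
  then have xI: "x \<notin> I" using subgroup.m_closed[OF I] by auto
  have "x \<otimes> x \<in> x <# I" using index_two_cosets(1)[OF fin I c x xI] n x by simp
  then have "x \<in> I" using mem_l_coset_iff[OF I x, of "x \<otimes> x"] x by (simp add: m_assoc[symmetric])
  then show False using xI by simp
qed

text \<open>The normaliser of I, in the coset form used by the definition of a normal
  subgroup.\<close>

lemma subgroup_normalizing:
  assumes I: "subgroup I G"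
  shows "subgroup {x \<in> carrier G. x <# I = I #> x} G"
proof (rule subgroupI)
  have IG: "I \<subseteq> carrier G" using subgroup.subset[OF I] .
  show "{x \<in> carrier G. x <# I = I #> x} \<noteq> {}"
    using lcos_mult_one[OF IG] coset_mult_one[OF IG] one_closed by (metis (mono_tags, lifting) empty_Collect_eq)
  fix x assume x: "x \<in> {x \<in> carrier G. x <# I = I #> x}"
  then have xc: "x \<in> carrier G" "x <# I = I #> x" by auto
  have "inv x <# I = inv x <# ((I #> x) #> inv x)"
    using xc IG by (simp add: coset_mult_assoc)
  also have "\<dots> = inv x <# ((x <# I) #> inv x)" using xc by simp
  also have "\<dots> = (inv x <# (x <# I)) #> inv x"
    using xc IG l_coset_subset_G[OF IG xc(1)] by (intro coset_assoc) auto
  also have "inv x <# (x <# I) = I"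
    using lcos_m_assoc[OF IG, of "inv x" x] xc(1) IG by (simp add: lcos_mult_one)
  finally show "inv x \<in> {x \<in> carrier G. x <# I = I #> x}" using xc by simp
  fix y assume y: "y \<in> {x \<in> carrier G. x <# I = I #> x}"
  then have yc: "y \<in> carrier G" "y <# I = I #> y" by auto
  have "(x \<otimes> y) <# I = x <# (y <# I)" by (rule lcos_m_assoc[OF IG xc(1) yc(1), symmetric])
  also have "\<dots> = (x <# I) #> y" unfolding yc(2) by (rule coset_assoc[OF xc(1) yc(1) IG])
  also have "\<dots> = I #> (x \<otimes> y)" using xc yc IG by (simp add: coset_mult_assoc)
  finally show "x \<otimes> y \<in> {x \<in> carrier G. x <# I = I #> x}" using xc yc by simp
qed auto

lemma normal_of_normalizing:
  assumes "subgroup I G" "{x \<in> carrier G. x <# I = I #> x} = carrier G"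
  shows "I \<lhd> G"
  using assms by (intro normalI) auto

text \<open>The normaliser of I contains M and an element outside M, so it is all of G by
  maximality.\<close>

lemma maximal_normalizing_eq:
  assumes mx: "maximal_in G M (carrier G)" and I: "subgroup I G" and g: "g \<in> carrier G" "g \<notin> M"
    and nM: "\<And>x. x \<in> M \<Longrightarrow> x <# I = I #> x" and ng: "g <# I = I #> g"
  shows "I \<lhd> G"
proof -
  have MG: "M \<subseteq> carrier G" using mx by (auto simp: maximal_in_def)
  let ?N = "{x \<in> carrier G. x <# I = I #> x}"
  have "?N = M \<or> ?N = carrier G"
  proof -
    have "M \<subseteq> ?N" using nM MG by auto
    moreover have "?N \<subseteq> carrier G" by blast
    ultimately show ?thesis using mx subgroup_normalizing[OF I] unfolding maximal_in_def by simp
  qed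
  moreover have "g \<in> ?N" using g ng by simp
  ultimately have "?N = carrier G" using g by auto
  then show ?thesis by (rule normal_of_normalizing[OF I])
qed

end

text \<open>A three-cycle has order 3, so p = p^4 is the square of p^2.\<close>

lemma three_cycle_square:
  assumes "p \<in> three_cycles n"
  shows "\<exists>q \<in> carrier (sym_group n). p = q \<circ> q"
proof -
  obtain cs where cs: "p = cycle_of_list cs" "cycle cs" "length cs = 3" "set cs \<subseteq> {1..n}"
    using assms by auto
  obtain a b c where abc: "cs = [a, b, c]" using stupid_lemma[OF cs(3)] by auto
  have d: "a \<noteq> b" "a \<noteq> c" "b \<noteq> c" using cs(2) abc by auto
  have p: "p x = (if x = a then b else if x = b then c else if x = c then a else x)" for x
    unfolding cs(1) abc using d by (simp add: transpose_def)
  have "p = (p \<circ> p) \<circ> (p \<circ> p)"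
  proof
    fix x
    consider "x = a" | "x = b" | "x = c" | "x \<noteq> a" "x \<noteq> b" "x \<noteq> c" by blast
    then show "p x = ((p \<circ> p) \<circ> (p \<circ> p)) x" using d by cases (simp_all add: p)
  qed
  moreover have "p permutes {1..n}" using permutes_subset[OF cycle_permutes cs(4)] cs(1) by simp
  ultimately show ?thesis using permutes_compose sym_group_carrier by metis
qed

text \<open>A subgroup of index two contains all squares, hence all three-cycles, and these generate
  the alternating group.\<close>

lemma alt_group_subset:
  assumes I: "subgroup I (sym_group n)" and c: "2 * card I = fact n"
  shows "carrier (alt_group n) \<subseteq> I"
proof -
  interpret S: group "sym_group n" by (rule sym_group_is_group)
  have fin: "finite (carrier (sym_group n))"
    using sym_group_card_carrier[of n] by (metis card.infinite fact_nonzero)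
  have tc: "three_cycles n \<subseteq> I"
  proof
    fix p assume "p \<in> three_cycles n"
    then obtain q where "q \<in> carrier (sym_group n)" "p = q \<circ> q" using three_cycle_square by blast
    then show "p \<in> I"
      using S.index_two_square_mem[OF fin I, of q] c sym_group_card_carrier[of n]
      by (simp add: sym_group_mult)
  qed
  have "p \<in> I" if "p \<in> generate (alt_group n) (three_cycles n)" for p
    using that
  proof (induction rule: generate.induct)
    case one
    then show ?case using subgroup.one_closed[OF I] by (simp only: alt_group_one sym_group_one)
  next
    case (incl h)
    then show ?case using tc by blast
  next
    case (inv h)
    then have "h \<in> carrier (alt_group n)" using three_cycles_incl by blast
    then have "inv\<^bsub>alt_group n\<^esub> h = inv\<^bsub>sym_group n\<^esub> h"
      using alt_group_inv_equality sym_group_inv_equality alt_group_carrier sym_group_carrier by metis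
    then show ?case using subgroup.m_inv_closed[OF I, of h] tc inv by auto
  next
    case (eng h1 h2)
    then show ?case using subgroup.m_closed[OF I eng.IH] by (simp only: alt_group_mult sym_group_mult)
  qed
  then show ?thesis unfolding alt_group_carrier_as_three_cycles by blast
qed

lemma embeds_alt_group:
  assumes h: "group_hom Q (sym_group n) h" "inj_on h (carrier Q)"
    and sub: "carrier (alt_group n) \<subseteq> h ` carrier Q"
  shows "embeds (alt_group n) Q"
proof -
  interpret h: group_hom Q "sym_group n" h by fact
  let ?f = "inv_into (carrier Q) h"
  have f: "?f p \<in> carrier Q" "h (?f p) = p" if "p \<in> carrier (alt_group n)" for p
    using that sub by (auto simp: inv_into_into f_inv_into_f subset_iff)
  have "?f \<in> hom (alt_group n) Q"
  proof (rule homI)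
    fix p q assume pq: "p \<in> carrier (alt_group n)" "q \<in> carrier (alt_group n)"
    have "p \<otimes>\<^bsub>alt_group n\<^esub> q = h (?f p \<otimes>\<^bsub>Q\<^esub> ?f q)"
      using f[OF pq(1)] f[OF pq(2)] by (simp add: alt_group_mult sym_group_mult)
    then show "?f (p \<otimes>\<^bsub>alt_group n\<^esub> q) = ?f p \<otimes>\<^bsub>Q\<^esub> ?f q"
      using inv_into_f_f[OF h(2) h.G.m_closed[OF f(1)[OF pq(1)] f(1)[OF pq(2)]]] by simp
  qed (use f in simp)
  moreover have "inj_on ?f (carrier (alt_group n))" using f(2) by (metis inj_onI)
  ultimately show ?thesis
    using alt_group_is_group h.G.is_group
    by (auto simp: embeds_def group_hom_def group_hom_axioms_def)
qed

text \<open>G acts on the left cosets of M. An element of the kernel fixes the coset M, so the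
  kernel lies in M and is trivial by \<open>core\<close>.\<close>

lemma (in group) coset_action:
  assumes M: "subgroup M G" and c: "card ((\<lambda>x. x <# M) ` carrier G) = n" "n > 0"
    and core: "\<And>L. L \<lhd> G \<Longrightarrow> L \<subseteq> M \<Longrightarrow> L = {\<one>}"
  shows "\<exists>h. group_hom G (sym_group n) h \<and> inj_on h (carrier G)"
proof -
  let ?L = "(\<lambda>x. x <# M) ` carrier G"
  have MG: "M \<subseteq> carrier G" using subgroup.subset[OF M] .
  have "finite ?L" using c by (metis card.infinite less_numeral_extra(3))
  then obtain b where b: "bij_betw b ?L {1..n}"
    using c(1) ex_bij_betw_nat_finite_1 bij_betw_inv_into by blast
  let ?i = "inv_into ?L b"
  have i: "?i k \<in> ?L" "b (?i k) = k" if "k \<in> {1..n}" for k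
    using that b by (auto simp: bij_betw_def inv_into_into f_inv_into_f)
  have ib: "?i (b X) = X" "b X \<in> {1..n}" if "X \<in> ?L" for X
    using that b by (auto simp: bij_betw_def)
  have act: "g <# X \<in> ?L" if "g \<in> carrier G" "X \<in> ?L" for g X
    using that MG by (auto simp: lcos_m_assoc)
  have act2: "g <# (k <# X) = (g \<otimes> k) <# X" if "g \<in> carrier G" "k \<in> carrier G" "X \<in> ?L" for g k X
    using that MG by (auto simp: lcos_m_assoc m_assoc)
  have act1: "\<one> <# X = X" if "X \<in> ?L" for X
    using that MG by (auto simp: lcos_m_assoc)
  \<comment> \<open>The cosets are numbered by b; outside 1..n the map is the identity, as
    \<open>permutes\<close> demands.\<close>
  define h where "h = (\<lambda>g k. if k \<in> {1..n} then b (g <# ?i k) else k)"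
  have h_in: "h g j = b (g <# ?i j)" if "j \<in> {1..n}" for g j unfolding h_def using that by (rule if_P)
  have h_out: "h g j = j" if "j \<notin> {1..n}" for g j unfolding h_def using that by (rule if_not_P)
  have hh: "h g \<circ> h k = h (g \<otimes> k)" if gk: "g \<in> carrier G" "k \<in> carrier G" for g k
  proof
    fix j show "(h g \<circ> h k) j = h (g \<otimes> k) j"
    proof (cases "j \<in> {1..n}")
      case True
      have kL: "k <# ?i j \<in> ?L" using act[OF gk(2) i(1)[OF True]] .
      show ?thesis
        unfolding o_apply h_in[OF True] h_in[OF ib(2)[OF kL]] ib(1)[OF kL]
          act2[OF gk i(1)[OF True]] ..
    next
      case False
      show ?thesis unfolding o_apply h_out[OF False] ..
    qed
  qed
  have h1: "h \<one> = id"
  proof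
    fix j show "h \<one> j = id j"
      using h_in[of j \<one>] h_out[of j \<one>] act1[OF i(1)] i(2) by (cases "j \<in> {1..n}") simp_all
  qed
  have perm: "h g permutes {1..n}" if g: "g \<in> carrier G" for g
  proof (rule bij_imp_permutes)
    show "bij_betw (h g) {1..n} {1..n}"
    proof (rule bij_betw_byWitness[where f' = "h (inv g)"])
      show "\<forall>a\<in>{1..n}. h (inv g) (h g a) = a"
        using hh[of "inv g" g] g h1 by (simp add: fun_eq_iff)
      show "\<forall>a\<in>{1..n}. h g (h (inv g) a) = a"
        using hh[of g "inv g"] g h1 by (simp add: fun_eq_iff)
      show "h g ` {1..n} \<subseteq> {1..n}"
        using ib(2)[OF act[OF g i(1)]] h_in by (intro image_subsetI) (simp only:)
      show "h (inv g) ` {1..n} \<subseteq> {1..n}"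
        using ib(2)[OF act[OF inv_closed[OF g] i(1)]] h_in by (intro image_subsetI) (simp only:)
    qed
  qed (rule h_out)
  have "h \<in> hom G (sym_group n)"
    using perm hh by (auto simp: hom_def sym_group_carrier sym_group_mult)
  then interpret h: group_hom G "sym_group n" h
    using is_group sym_group_is_group by (simp add: group_hom_def group_hom_axioms_def)
  have "kernel G (sym_group n) h \<subseteq> M"
  proof
    fix g assume "g \<in> kernel G (sym_group n) h"
    then have g: "g \<in> carrier G" "h g = id" by (auto simp: kernel_def sym_group_one)
    have M_in: "M \<in> ?L" using lcos_mult_one[OF MG] one_closed by (metis image_eqI)
    have "h g (b M) = b (g <# M)" using h_in[OF ib(2)[OF M_in]] ib(1)[OF M_in] by simp
    then have "b (g <# M) = b M" using g by simp
    then have "g <# M = M" using ib(1)[OF M_in] ib(1)[OF act[OF g(1) M_in]] by simp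
    then show "g \<in> M" using lcos_self[OF g(1) M] by simp
  qed
  then have "kernel G (sym_group n) h = {\<one>}" using core h.normal_kernel by blast
  then have "inj_on h (carrier G)" using h.inj_iff_trivial_ker by simp
  then show ?thesis using h.group_hom_axioms by blast
qed

section \<open>Primitive groups with large transversal probabilities\<close>

context group
begin

section \<open>The double coset H and the remaining ones\<close>

lemma double_coset_mem:
  assumes H: "subgroup H G" and x: "x \<in> H"
  shows "double_coset G H x = H"
proof -
  have HG: "H \<subseteq> carrier G" using subgroup.subset[OF H] .
  have "double_coset G H \<one> = H"
  proof (intro equalityI subsetI)
    fix y assume "y \<in> double_coset G H \<one>"
    then show "y \<in> H" using subgroup.m_closed[OF H] HG by (auto simp: double_coset_def subset_iff)
  next
    fix y assume y: "y \<in> H"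
    then have "y = y \<otimes> \<one> \<otimes> \<one>" using HG by auto
    then show "y \<in> double_coset G H \<one>"
      using y subgroup.one_closed[OF H] unfolding double_coset_def by blast
  qed
  then show ?thesis using double_coset_eq[OF H one_closed, of x] x by simp
qed

lemma double_coset_notin:
  assumes H: "subgroup H G" and g: "g \<in> carrier G" "g \<notin> H"
  shows "double_coset G H g \<noteq> H"
  using double_coset_self[OF H g(1)] g(2) by auto

lemma normalizing_of_ratio_one:
  assumes H: "subgroup H G" and fin: "finite (carrier G)" and g: "g \<in> carrier G"
    and one: "card (double_coset G H g) div card H = 1"
  shows "g <# H = H #> g"
proof -
  have c: "card (double_coset G H g) = card H"
    using double_coset_counts(1)[OF H fin g] one by simp
  have f: "finite (double_coset G H g)" using double_coset_subset[OF H g] fin finite_subset by auto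
  have "g <# H = double_coset G H g"
    using l_coset_subset_double_coset[OF H g] card_l_coset[OF H g] c f by (intro card_subset_eq) auto
  moreover have "H #> g = double_coset G H g"
    using r_coset_subset_double_coset[OF H g] card_r_coset[OF H g] c f by (intro card_subset_eq) auto
  ultimately show ?thesis by simp
qed

lemma sum_card_double_cosets:
  assumes H: "subgroup H G" and fin: "finite (carrier G)"
  shows "(\<Sum>D\<in>double_cosets G H. card D) = card (carrier G)"
proof -
  have "card (\<Union>(double_cosets G H)) = (\<Sum>D\<in>double_cosets G H. card D)"
  proof (rule card_Union_disjoint)
    show "pairwise disjnt (double_cosets G H)"
    proof (rule pairwiseI)
      fix D E assume "D \<in> double_cosets G H" "E \<in> double_cosets G H" "D \<noteq> E"
      then show "disjnt D E" using double_cosets_eqI[OF H] unfolding disjnt_iff by metis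
    qed
    show "finite D" if "D \<in> double_cosets G H" for D
      using that Union_double_cosets[OF H] fin by (metis Union_upper finite_subset)
  qed
  then show ?thesis using Union_double_cosets[OF H] by simp
qed

lemma mem_double_cosets_self:
  assumes H: "subgroup H G"
  shows "H \<in> double_cosets G H"
  using double_coset_mem[OF H subgroup.one_closed[OF H]] unfolding double_cosets_def
  by (metis image_eqI one_closed)

lemma transversal_prob_eq_proper:
  assumes H: "subgroup H G" and fin: "finite (carrier G)"
  shows "transversal_prob G H =
    (\<Prod>D\<in>double_cosets G H - {H}. transversal_factor (card D div card H))"
proof -
  have Hpos: "card H > 0" using subgroup.finite_imp_card_positive[OF H fin] .
  have "finite (double_cosets G H)" using fin by (simp add: double_cosets_def)
  then show ?thesis
    unfolding transversal_prob_eq[OF H fin]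
    using Hpos transversal_factor_simps(1)
    by (subst prod.remove[OF _ mem_double_cosets_self[OF H]]) simp_all
qed

lemma card_eq_sum_proper:
  assumes H: "subgroup H G" and fin: "finite (carrier G)"
  shows "card (carrier G) = card H + (\<Sum>D\<in>double_cosets G H - {H}. card D)"
proof -
  have "finite (double_cosets G H)" using fin by (simp add: double_cosets_def)
  then show ?thesis
    using sum_card_double_cosets[OF H fin] sum.remove[OF _ mem_double_cosets_self[OF H], of card]
    by simp
qed

lemma proper_double_cosetE:
  assumes H: "subgroup H G" and D: "D \<in> double_cosets G H - {H}"
  obtains g where "g \<in> carrier G" "g \<notin> H" "D = double_coset G H g"
  using D double_coset_mem[OF H] unfolding double_cosets_def by blast

lemma inv_involution: "t \<in> carrier G \<Longrightarrow> t \<otimes> t = \<one> \<Longrightarrow> inv t = t"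
  by (rule inv_equality)

lemma order_two_subgroup:
  assumes M: "subgroup M G" and c: "card M = 2"
  obtains t where "M = {\<one>, t}" "t \<in> carrier G" "t \<noteq> \<one>" "t \<otimes> t = \<one>"
proof -
  obtain a b where ab: "M = {a, b}" "a \<noteq> b" using c by (auto simp: card_2_iff)
  then obtain t where t: "M = {\<one>, t}" "t \<noteq> \<one>"
    using subgroup.one_closed[OF M] by (metis insertE insert_commute singletonD)
  have tc: "t \<in> carrier G" using t subgroup.mem_carrier[OF M] by blast
  have "t \<otimes> t \<in> M" using t subgroup.m_closed[OF M] by blast
  moreover have "t \<otimes> t \<noteq> t" using t(2) tc by (simp add: l_cancel_one)
  ultimately show ?thesis using that t tc by blast
qed

end

text \<open>G acts faithfully and primitively on the cosets of M. Non-normality excludes only the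
  case of trivial M, where G has prime order.\<close>

locale primitive_group = group +
  fixes M
  assumes fin: "finite (carrier G)"
    and maximal: "maximal_in G M (carrier G)"
    and not_normal: "\<not> M \<lhd> G"
    and core_free: "L \<lhd> G \<Longrightarrow> L \<subseteq> M \<Longrightarrow> L = {\<one>}"
begin

lemma M_subgroup: "subgroup M G" and M_subset: "M \<subseteq> carrier G" and M_psubset: "M \<subset> carrier G"
  using maximal by (auto simp: maximal_in_def)

lemma finite_M: "finite M"
  using finite_subset[OF M_subset fin] .

lemma card_M_pos: "card M > 0"
  using subgroup.finite_imp_card_positive[OF M_subgroup fin] .

lemma subgroup_eq_carrier:
  assumes "subgroup S G" "M \<subseteq> S" "x \<in> S" "x \<notin> M"
  shows "S = carrier G"
  using assms maximal subgroup.subset[OF assms(1)] unfolding maximal_in_def by blast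

text \<open>By maximality M would otherwise be normal; so M is its own normaliser, and only the
  double coset M itself has ratio 1.\<close>

lemma not_normalizing:
  assumes "g \<in> carrier G" "g \<notin> M"
  shows "g <# M \<noteq> M #> g"
proof
  assume "g <# M = M #> g"
  moreover have "x <# M = M #> x" if "x \<in> M" for x
    using that M_subset coset_join2[OF _ M_subgroup] coset_join3[OF _ M_subgroup] by auto
  ultimately have "M \<lhd> G" using maximal_normalizing_eq[OF maximal M_subgroup assms] by simp
  then show False using not_normal by simp
qed

lemma not_commuting:
  assumes M: "M = {\<one>, t}" and g: "g \<in> carrier G" "g \<notin> M"
  shows "g \<otimes> t \<noteq> t \<otimes> g"
proof
  assume "g \<otimes> t = t \<otimes> g"
  then have "g <# M = M #> g" using g(1) by (auto simp: M l_coset_def r_coset_def)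
  then show False using not_normalizing[OF g] by simp
qed

lemma ratio_ge_2:
  assumes g: "g \<in> carrier G" "g \<notin> M"
  shows "card (double_coset G M g) div card M \<ge> 2"
proof -
  have "card (double_coset G M g) div card M \<noteq> 0"
    using double_coset_counts(4)[OF M_subgroup fin g(1)] card_M_pos by (metis mult_0 less_not_refl)
  moreover have "card (double_coset G M g) div card M \<noteq> 1"
    using normalizing_of_ratio_one[OF M_subgroup fin g(1)] not_normalizing[OF g] by blast
  ultimately show ?thesis by linarith
qed

text \<open>If \<open>M \<inter> gMg\<^sup>-\<^sup>1\<close> has index two in \<open>M\<close>, then it has index two in the conjugate as well; hence it is
  normalised by both, that is, by \<open>G\<close>.\<close>

lemma card_eq_2_of_ratio_2:
  assumes g: "g \<in> carrier G" and two: "card (double_coset G M g) div card M = 2"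
  shows "card M = 2"
proof -
  let ?c = "\<lambda>x. inv g \<otimes> x \<otimes> g"
  have "?c \<in> hom G G"
  proof (rule homI)
    fix x y assume xy: "x \<in> carrier G" "y \<in> carrier G"
    have "?c x \<otimes> ?c y = inv g \<otimes> x \<otimes> ((g \<otimes> inv g) \<otimes> y) \<otimes> g"
      using xy g by (simp only: m_assoc inv_closed m_closed)
    then show "?c (x \<otimes> y) = ?c x \<otimes> ?c y" using xy g by (simp add: m_assoc)
  qed (use g in simp)
  then interpret c: group_hom G G ?c
    using is_group by (simp add: group_hom_def group_hom_axioms_def)
  \<comment> \<open>This is the conjugate g M g^-1, obtained as a preimage so that it is a subgroup
    at once.\<close>
  define M' where "M' = {x \<in> carrier G. ?c x \<in> M}"
  have M': "subgroup M' G" unfolding M'_def by (rule c.subgroup_preimage[OF M_subgroup])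
  have M'G: "M' \<subseteq> carrier G" by (auto simp: M'_def)
  have gg: "g \<otimes> (inv g \<otimes> x \<otimes> g) \<otimes> inv g = x" "inv g \<otimes> (g \<otimes> x \<otimes> inv g) \<otimes> g = x"
    if x: "x \<in> carrier G" for x
  proof -
    have "g \<otimes> (inv g \<otimes> x \<otimes> g) \<otimes> inv g = (g \<otimes> inv g) \<otimes> x \<otimes> (g \<otimes> inv g)"
      using x g by (simp only: m_assoc inv_closed m_closed)
    then show "g \<otimes> (inv g \<otimes> x \<otimes> g) \<otimes> inv g = x" using x g by simp
    have "inv g \<otimes> (g \<otimes> x \<otimes> inv g) \<otimes> g = (inv g \<otimes> g) \<otimes> x \<otimes> (inv g \<otimes> g)"
      using x g by (simp only: m_assoc inv_closed m_closed)
    then show "inv g \<otimes> (g \<otimes> x \<otimes> inv g) \<otimes> g = x" using x g by simp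
  qed
  have "bij_betw ?c M' M"
    using gg g M_subset
    by (intro bij_betw_byWitness[where f' = "\<lambda>x. g \<otimes> x \<otimes> inv g"]) (auto simp: M'_def subset_iff)
  then have cM': "card M' = card M" by (rule bij_betw_same_card)
  define I where "I = M \<inter> M'"
  have I: "subgroup I G" unfolding I_def using M_subgroup M' by (rule subgroups_Inter_pair)
  \<comment> \<open>Right translation by g carries I to the intersection of gM and Mg, whose size is
    |M| divided by the ratio, here |M|/2.\<close>
  have "bij_betw (\<lambda>x. x \<otimes> g) I ((g <# M) \<inter> (M #> g))"
  proof (rule bij_betw_byWitness[where f' = "\<lambda>x. x \<otimes> inv g"])
    show "\<forall>a\<in>I. a \<otimes> g \<otimes> inv g = a" using g M_subset by (auto simp: I_def m_assoc subset_iff)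
    show "\<forall>a\<in>(g <# M) \<inter> (M #> g). a \<otimes> inv g \<otimes> g = a"
      using g M_subset by (auto simp: r_coset_def m_assoc subset_iff)
    show "(\<lambda>x. x \<otimes> g) ` I \<subseteq> (g <# M) \<inter> (M #> g)"
    proof (rule image_subsetI)
      fix x assume "x \<in> I"
      then have x: "x \<in> M" "x \<in> carrier G" "?c x \<in> M" by (auto simp: I_def M'_def)
      then show "x \<otimes> g \<in> (g <# M) \<inter> (M #> g)"
        using g mem_l_coset_iff[OF M_subgroup g, of "x \<otimes> g"]
          mem_r_coset_iff[OF M_subgroup g, of "x \<otimes> g"] by (simp add: m_assoc)
    qed
    show "(\<lambda>x. x \<otimes> inv g) ` ((g <# M) \<inter> (M #> g)) \<subseteq> I"
    proof (rule image_subsetI)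
      fix x assume x: "x \<in> (g <# M) \<inter> (M #> g)"
      then have xc: "x \<in> carrier G" using r_coset_subset_G[OF M_subset g] by blast
      have "x \<otimes> inv g \<in> M" using x mem_r_coset_iff[OF M_subgroup g xc] by simp
      moreover have "inv g \<otimes> x \<in> M" using x mem_l_coset_iff[OF M_subgroup g xc] by simp
      ultimately show "x \<otimes> inv g \<in> I" using g xc by (simp add: I_def M'_def m_assoc)
    qed
  qed
  then have "card I = card ((g <# M) \<inter> (M #> g))" by (rule bij_betw_same_card)
  then have cI: "2 * card I = card M"
    using double_coset_counts(4)[OF M_subgroup fin g] two by simp
  have nrm: "x <# I = I #> x" if V: "subgroup V G" "I \<subseteq> V" "2 * card I = card V" "x \<in> V" for V x
  proof -
    interpret V: group "G\<lparr>carrier := V\<rparr>" using subgroup_imp_group[OF V(1)] .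
    have "finite V" using subgroup.subset[OF V(1)] fin finite_subset by auto
    then show ?thesis
      using V.index_two_coset_eq[of I x] subgroup_incl[OF I V(1,2)] V(3,4) by simp
  qed
  \<comment> \<open>Otherwise I would equal M' and have |M| elements instead of half as
    many.\<close>
  have "\<not> M' \<subseteq> M"
  proof
    assume "M' \<subseteq> M"
    then have "I = M'" by (auto simp: I_def)
    then show False using cI cM' card_M_pos by simp
  qed
  then obtain y where y: "y \<in> M'" "y \<notin> M" by auto
  have "I \<lhd> G"
  proof (rule maximal_normalizing_eq[OF maximal I _ y(2)])
    show "y \<in> carrier G" using y M'G by auto
    show "x <# I = I #> x" if "x \<in> M" for x using nrm[OF M_subgroup _ cI that] by (simp add: I_def)
    show "y <# I = I #> y" using nrm[OF M' _ _ y(1)] cI cM' by (simp add: I_def)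
  qed
  then have "I = {\<one>}" using core_free by (simp add: I_def)
  then show ?thesis using cI by simp
qed

end

section \<open>The cases k = 2, 3 and 4\<close>

context primitive_group
begin

text \<open>The ratio of a double coset divides |M| = 2, so every further double coset has ratio 2
  and 4 elements. If there are j of them, the probability is (1/2)^j and |G| = 2 + 4j. Being
  generated by two involutions, G is dihedral with n = 1 + 2j.\<close>

lemma involution_case:
  assumes c: "card M = 2" and P: "transversal_prob G M > 4 / 81"
  shows "embeds (dihedral_group 3) G \<or> embeds (dihedral_group 5) G \<or> embeds (dihedral_group 7) G"
proof -
  obtain t where t: "M = {\<one>, t}" "t \<in> carrier G" "t \<noteq> \<one>" "t \<otimes> t = \<one>"
    using order_two_subgroup[OF M_subgroup c] .
  let ?E = "double_cosets G M - {M}"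
  have two: "card D div card M = 2 \<and> card D = 4" if D: "D \<in> ?E" for D
  proof -
    obtain g where g: "g \<in> carrier G" "g \<notin> M" "D = double_coset G M g"
      using proper_double_cosetE[OF M_subgroup D] .
    let ?k = "card D div card M"
    have "?k dvd 2" using double_coset_counts(4)[OF M_subgroup fin g(1)] c g(3) by (metis dvd_triv_left)
    then have "?k \<le> 2" by (rule dvd_imp_le) simp
    then have "?k = 2" using ratio_ge_2[OF g(1,2)] g(3) by simp
    then show ?thesis using double_coset_counts(1)[OF M_subgroup fin g(1)] g(3) c by simp
  qed
  define j where "j = card ?E"
  have "transversal_prob G M = (1/2) ^ j"
  proof -
    have "transversal_prob G M = (\<Prod>D\<in>?E. 1/2)"
      unfolding transversal_prob_eq_proper[OF M_subgroup fin]
    proof (intro prod.cong refl)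
      fix D assume "D \<in> ?E"
      then have "card D div card M = 2" using two by blast
      then show "transversal_factor (card D div card M) = 1/2"
        unfolding transversal_factor_simps(2)[symmetric] by (rule arg_cong)
    qed
    then show ?thesis by (simp add: j_def)
  qed
  then have half: "(1/2 :: real) ^ j > 4 / 81" using P by simp
  \<comment> \<open>The fifth power of 1/2 is 1/32, which is below 4/81.\<close>
  have "j \<le> 4"
  proof (rule ccontr)
    assume "\<not> j \<le> 4"
    then have "(1/2 :: real) ^ j \<le> (1/2) ^ 5" by (intro power_decreasing) auto
    moreover have "(1/2 :: real) ^ 5 = 1/32" by (simp add: power_divide)
    ultimately show False using half by linarith
  qed
  have cG: "card (carrier G) = 2 + 4 * j"
    using card_eq_sum_proper[OF M_subgroup fin] two c by (simp add: j_def)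
  have "card M < card (carrier G)" using psubset_card_mono[OF fin M_psubset] .
  then have "j \<ge> 1" using cG c by simp
  obtain g where g: "g \<in> carrier G" "g \<notin> M" using M_psubset by auto
  \<comment> \<open>A second involution, conjugate to t. It lies outside M, so by maximality t and u
    generate G; the rotation is their product.\<close>
  define u where "u = g \<otimes> t \<otimes> inv g"
  have u: "u \<in> carrier G" using g t by (simp add: u_def)
  have ug: "u \<otimes> g = g \<otimes> t" using g t by (simp add: u_def m_assoc)
  have uu: "u \<otimes> u = \<one>"
  proof -
    have "u \<otimes> u = g \<otimes> (t \<otimes> ((inv g \<otimes> g) \<otimes> t)) \<otimes> inv g"
      unfolding u_def using g t by (simp only: m_assoc inv_closed m_closed)
    then show ?thesis using g t by simp
  qed
  have "u \<noteq> \<one>" using ug g t by auto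
  moreover have "u \<noteq> t" using not_commuting[OF t(1) g] ug by auto
  ultimately have uM: "u \<notin> M" using t(1) by simp
  define r where "r = t \<otimes> u"
  have r: "r \<in> carrier G" using t u by (simp add: r_def)
  have tr: "t \<otimes> r = u" using t u by (simp add: r_def m_assoc[symmetric])
  have "inv r = u \<otimes> t" using t u uu by (simp add: r_def inv_mult_group inv_involution)
  then have trt: "t \<otimes> r = inv r \<otimes> t" using tr t u by (simp add: m_assoc)
  \<comment> \<open>As a power of r, t would commute with r = tu and hence with u.\<close>
  have nt: "t \<notin> generate G {r}"
  proof
    assume "t \<in> generate G {r}"
    then obtain i :: int where "t = r [^] i" using generate_pow[OF r] by blast
    then have "r \<otimes> t = t \<otimes> r"
      using int_pow_mult[OF r, of 1 i] int_pow_mult[OF r, of i 1] r by (simp add: add.commute)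
    then have "u = r \<otimes> t" using tr by simp
    then have "t \<otimes> u = t \<otimes> r \<otimes> t" using t r by (simp add: m_assoc)
    then show False using tr not_commuting[OF t(1) u uM] by simp
  qed
  define n where "n = ord r"
  have npos: "n > 0" using ord_ge_1[OF fin r] by (simp add: n_def)
  obtain f where f: "group_hom (dihedral_group n) G f" "inj_on f (carrier (dihedral_group n))"
    "t \<in> f ` carrier (dihedral_group n)" "r \<in> f ` carrier (dihedral_group n)"
    using dihedral_embedding[OF t(2,4) r n_def[symmetric] npos trt nt] by blast
  interpret f: group_hom "dihedral_group n" G f by fact
  have S: "subgroup (f ` carrier (dihedral_group n)) G" by (rule f.img_is_subgroup)
  have "f ` carrier (dihedral_group n) = carrier G"
  proof (rule subgroup_eq_carrier[OF S])
    show "M \<subseteq> f ` carrier (dihedral_group n)" using t(1) f(3) subgroup.one_closed[OF S] by simp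
    show "u \<in> f ` carrier (dihedral_group n)" using subgroup.m_closed[OF S f(3,4)] tr by simp
  qed (rule uM)
  then have "card (carrier G) = 2 * n"
    using card_image[OF f(2)] order_dihedral_group[of n] by (simp add: order_def)
  then have "n = 1 + 2 * j" using cG by simp
  moreover have "j = 1 \<or> j = 2 \<or> j = 3 \<or> j = 4" using \<open>j \<le> 4\<close> \<open>j \<ge> 1\<close> by linarith
  ultimately consider "n = 3" | "n = 5" | "n = 7" | "n = 9" by auto
  then show ?thesis
  proof cases
    \<comment> \<open>Here n = 9; the cube of r has order 3 and is still inverted by t, which yields
      D_3.\<close>
    case 4
    let ?s = "r [^] (3::nat)"
    have s: "?s \<in> carrier G" using r by simp
    have "ord ?s = 3" using ord_pow[OF r, of 3] 4 by (simp add: n_def)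
    moreover have "t \<otimes> ?s = inv ?s \<otimes> t" by (rule involution_conj_pow[OF t(2) r trt])
    moreover have "t \<notin> generate G {?s}"
    proof -
      have "?s \<in> generate G {r}"
        unfolding generate_pow[OF r] using int_pow_int[of G r 3] by (metis (mono_tags, lifting) UNIV_I mem_Collect_eq)
      then have "generate G {?s} \<subseteq> generate G {r}"
        using r generate_is_subgroup[of "{r}"] by (intro generate_subgroup_incl) auto
      then show ?thesis using nt by auto
    qed
    ultimately have "embeds (dihedral_group 3) G"
      using dihedral_embedding[OF t(2,4) s, of 3] by (auto simp: embeds_def)
    then show ?thesis by simp
  qed (use f embeds_def in blast)+
qed

text \<open>G acts faithfully on the four cosets of M, so 4|M| divides 24. As 3 divides |M|, the
  image has order 12 or 24 in S_4.\<close>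

lemma four_cosets_case:
  assumes cG: "card (carrier G) = 4 * card M" and three: "3 dvd card M"
  shows "embeds (alt_group 4) G"
proof -
  let ?l = "\<lambda>x. x <# M"
  have "{y \<in> carrier G. y <# M = x <# M} = x <# M" if x: "x \<in> carrier G" for x
    using l_coset_eq_iff[OF M_subgroup x] l_coset_subset_G[OF M_subset x] by auto
  then have "card (carrier G) = card (?l ` carrier G) * card M"
    using card_l_coset[OF M_subgroup] by (intro card_by_fibres[OF fin]) simp
  then have "card (?l ` carrier G) = 4" using cG card_M_pos by simp
  then obtain h where h: "group_hom G (sym_group 4) h" "inj_on h (carrier G)"
    using coset_action[OF M_subgroup _ _ core_free, of 4] by auto
  interpret h: group_hom G "sym_group 4" h by fact
  let ?I = "h ` carrier G"
  have I: "subgroup ?I (sym_group 4)" by (rule h.img_is_subgroup)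
  have cI: "card ?I = 4 * card M" using card_image[OF h(2)] cG by simp
  have cS: "card (carrier (sym_group 4)) = 24" by (simp add: sym_group_card_carrier fact_numeral)
  then have finS: "finite (carrier (sym_group 4))" by (metis card.infinite zero_neq_numeral)
  have "card ?I dvd 24"
    using h.H.lagrange[OF I] cS by (metis dvd_triv_right order_def)
  then have "card M dvd 6" using cI nat_mult_dvd_cancel_disj[of 4 "card M" 6] by simp
  moreover obtain q where "card M = 3 * q" using three by blast
  ultimately have "q dvd 2" by simp
  then have "q \<le> 2" by (rule dvd_imp_le) simp
  moreover have "q \<noteq> 0" using card_M_pos \<open>card M = 3 * q\<close> by simp
  ultimately have "q = 1 \<or> q = 2" by linarith
  then have "card ?I = 12 \<or> card ?I = 24" using cI \<open>card M = 3 * q\<close> by auto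
  then have "carrier (alt_group 4) \<subseteq> ?I"
  proof
    assume "card ?I = 12"
    then show ?thesis using alt_group_subset[OF I] by (simp add: fact_numeral)
  next
    assume "card ?I = 24"
    then have "?I = carrier (sym_group 4)"
      using finS cS subgroup.subset[OF I] by (intro card_subset_eq) auto
    then show ?thesis by (auto simp: alt_group_carrier sym_group_carrier)
  qed
  then show ?thesis using embeds_alt_group[OF h] by simp
qed

text \<open>A normal subgroup S of order 5 is found. The elements of M centralising S form a normal
  subgroup of G inside M, which is trivial, so an involution of M acts on S nontrivially and hence
  by inversion.\<close>

lemma five_cosets_case:
  assumes cG: "card (carrier G) = 5 * card M" and even: "2 dvd card M"
    and P: "\<And>H. subgroup H G \<Longrightarrow> transversal_prob G H > 4 / 81"
  shows "embeds (dihedral_group 5) G"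
proof -
  obtain S where S: "subgroup S G" "card S = 5"
    \<comment> \<open>Only a subgroup of order 5^1 is asked for; the cofactor |M| may be
      arbitrary.\<close>
    using sylow_thm[of 5 G 1 "card M"] cG fin is_group by (auto simp: order_def)
  have SG: "S \<subseteq> carrier G" using subgroup.subset[OF S(1)] .
  have S_normal: "S \<lhd> G"
  proof (rule normalI[OF S(1)], rule ballI)
    fix g assume g: "g \<in> carrier G"
    let ?k = "card (double_coset G S g) div card S"
    have "?k dvd 5" using double_coset_counts(4)[OF S(1) fin g] S(2) by (metis dvd_triv_left)
    moreover have "prime (5::nat)" by simp
    ultimately have "?k = 1 \<or> ?k = 5" unfolding prime_nat_iff by blast
    \<comment> \<open>A single double coset of ratio 5 would push the probability of S down to
      24/625, below 4/81. So all ratios are 1 and S is normal.\<close>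
    moreover have "?k \<noteq> 5"
    proof
      assume k: "?k = 5"
      have "{double_coset G S g} \<subseteq> double_cosets G S" using g by (simp add: double_cosets_def)
      then have "transversal_prob G S \<le> (\<Prod>D\<in>{double_coset G S g}. transversal_factor (card D div card S))"
        unfolding transversal_prob_eq[OF S(1) fin]
        using fin by (intro prod_transversal_factor_subset) (auto simp: double_cosets_def)
      then show False using P[OF S(1)] k transversal_factor_simps(4) by simp
    qed
    ultimately have "?k = 1" by simp
    from normalizing_of_ratio_one[OF S(1) fin g this] show "S #> g = g <# S" by simp
  qed
  have gen: "generate G {y} = S" if y: "y \<in> S" "y \<noteq> \<one>" for y
  proof -
    have yc: "y \<in> carrier G" using y SG by auto
    have sub: "generate G {y} \<subseteq> S" using y by (intro generate_subgroup_incl[OF _ S(1)]) simp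
    have gs: "subgroup (generate G {y}) G" using yc by (intro generate_is_subgroup) simp
    interpret S: group "G\<lparr>carrier := S\<rparr>" using subgroup_imp_group[OF S(1)] .
    have "subgroup (generate G {y}) (G\<lparr>carrier := S\<rparr>)" by (rule subgroup_incl[OF gs S(1) sub])
    then have "card (generate G {y}) dvd 5"
      using S.lagrange[of "generate G {y}"] S(2) by (metis dvd_triv_right order_def partial_object.simps(1)
          partial_object.surjective partial_object.update_convs(1))
    moreover have "prime (5::nat)" by simp
    ultimately have "card (generate G {y}) = 1 \<or> card (generate G {y}) = 5"
      unfolding prime_nat_iff by blast
    moreover have "card (generate G {y}) \<noteq> 1"
      using generate_pow_card[OF yc] ord_eq_1[OF yc] y(2) by simp
    ultimately show ?thesis
      using sub S(2) finite_subset[OF SG fin] by (intro card_subset_eq) auto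
  qed
  have ord5: "ord y = 5" if "y \<in> S" "y \<noteq> \<one>" for y
    using generate_pow_card[of y] gen[OF that] that SG S(2) by auto
  obtain x where x: "x \<in> S" "x \<noteq> \<one>"
  proof -
    have "\<not> S \<subseteq> {\<one>}"
    proof
      assume "S \<subseteq> {\<one>}"
      then have "card S \<le> card {\<one>}" by (intro card_mono) simp_all
      then show False using S(2) by simp
    qed
    then show ?thesis using that by auto
  qed
  have xc: "x \<in> carrier G" using x SG by auto
  have S_comm: "a \<otimes> b = b \<otimes> a" if ab: "a \<in> S" "b \<in> S" for a b
  proof -
    obtain i j :: int where "a = x [^] i" "b = x [^] j"
      using ab gen[OF x] generate_pow[OF xc] by blast
    then show ?thesis using xc by (simp add: int_pow_mult[symmetric] add.commute)
  qed
  obtain t where t: "t \<in> M" "t \<noteq> \<one>" "t \<otimes> t = \<one>" "t \<in> carrier G"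
  proof -
    interpret Mg: group "G\<lparr>carrier := M\<rparr>" using subgroup_imp_group[OF M_subgroup] .
    obtain q where "card M = 2 * q" using even by blast
    then obtain T where T: "subgroup T (G\<lparr>carrier := M\<rparr>)" "card T = 2"
      using sylow_thm[of 2 "G\<lparr>carrier := M\<rparr>" 1 q] finite_M Mg.is_group by (auto simp: order_def)
    have "subgroup T G" using incl_subgroup[OF M_subgroup T(1)] .
    from order_two_subgroup[OF this T(2)] obtain t where "T = {\<one>, t}" "t \<in> carrier G" "t \<noteq> \<one>" "t \<otimes> t = \<one>" .
    then show ?thesis using that subgroup.subset[OF T(1)] by auto
  qed
  \<comment> \<open>The centraliser of S in M, expressed by commutators modulo the trivial subgroup
    so that \<open>normal_comm_mem\<close> applies.\<close>
  define C where "C = M \<inter> {a \<in> carrier G. \<forall>s\<in>S. comm G a s \<in> {\<one>}}"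
  have comm1: "comm G a s = \<one> \<longleftrightarrow> a \<otimes> s = s \<otimes> a" if "a \<in> carrier G" "s \<in> carrier G" for a s
  proof
    assume "comm G a s = \<one>"
    then show "a \<otimes> s = s \<otimes> a" using comm_mult[OF that] that by simp
  next
    assume "a \<otimes> s = s \<otimes> a"
    then have "comm G a s = s \<otimes> a \<otimes> inv a \<otimes> inv s" by (simp add: comm_def)
    then show "comm G a s = \<one>" using that by (simp add: m_assoc)
  qed
  have Z: "{a \<in> carrier G. \<forall>s\<in>S. comm G a s \<in> {\<one>}} \<lhd> G"
    by (rule normal_comm_mem[OF one_is_normal S_normal])
  have Zs: "subgroup {a \<in> carrier G. \<forall>s\<in>S. comm G a s \<in> {\<one>}} G" using Z normal_imp_subgroup by blast
  have C: "subgroup C G" unfolding C_def by (rule subgroups_Inter_pair[OF M_subgroup Zs])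
  obtain y where y: "y \<in> S" "y \<notin> M"
  proof (rule ccontr)
    assume "\<not> thesis"
    then have "S \<subseteq> M" using that by auto
    then have "S = {\<one>}" using core_free[OF S_normal] by simp
    then show False using x by simp
  qed
  \<comment> \<open>M normalises C, the intersection of M with a normal subgroup of G; y lies in S
    and commutes with C elementwise.\<close>
  have "C \<lhd> G"
  proof (rule maximal_normalizing_eq[OF maximal C _ y(2)])
    show yc: "y \<in> carrier G" using y SG by auto
    have cy: "y \<otimes> a = a \<otimes> y" if "a \<in> C" for a
      using that y comm1[of a y] yc by (auto simp: C_def)
    show "y <# C = C #> y" unfolding l_coset_def r_coset_def using cy by auto
  next
    fix a assume a: "a \<in> M"
    interpret Mg: group "G\<lparr>carrier := M\<rparr>" using subgroup_imp_group[OF M_subgroup] .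
    have "C \<lhd> G\<lparr>carrier := M\<rparr>"
    proof (rule Mg.normal_inv_iff[THEN iffD2], intro conjI ballI)
      show "subgroup C (G\<lparr>carrier := M\<rparr>)" by (rule subgroup_incl[OF C M_subgroup]) (simp add: C_def)
      fix z c assume zc: "z \<in> carrier (G\<lparr>carrier := M\<rparr>)" "c \<in> C"
      then have zM: "z \<in> M" by simp
      then have "z \<otimes> c \<otimes> inv z \<in> M"
        using zc(2) subgroup.m_closed[OF M_subgroup] subgroup.m_inv_closed[OF M_subgroup] by (simp add: C_def)
      moreover have "z \<otimes> c \<otimes> inv z \<in> {a \<in> carrier G. \<forall>s\<in>S. comm G a s \<in> {\<one>}}"
        using normal_invE(2)[OF Z, of z c] zM zc(2) M_subset by (auto simp: C_def)
      ultimately show "z \<otimes>\<^bsub>G\<lparr>carrier := M\<rparr>\<^esub> c \<otimes>\<^bsub>G\<lparr>carrier := M\<rparr>\<^esub> inv\<^bsub>G\<lparr>carrier := M\<rparr>\<^esub> z \<in> C"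
        using m_inv_consistent[OF M_subgroup zM] by (simp add: C_def)
    qed
    from normal.coset_eq[OF this] show "a <# C = C #> a" using a by simp
  qed
  then have C1: "C = {\<one>}" by (rule core_free) (simp add: C_def)
  have not_central: "\<exists>s\<in>S. t \<otimes> s \<noteq> s \<otimes> t"
  proof (rule ccontr)
    assume "\<not> ?thesis"
    then have "t \<in> C" using t comm1[of t] SG by (auto simp: C_def)
    then show False using C1 t by simp
  qed
  have ti: "inv t = t" using inv_involution t by simp
  define z where "z = t \<otimes> x \<otimes> t"
  have zS: "z \<in> S" using normal_invE(2)[OF S_normal t(4) x(1)] by (simp add: z_def ti)
  have zc: "z \<in> carrier G" using zS SG by auto
  have tz: "t \<otimes> z = x \<otimes> t" using t xc by (simp add: z_def m_assoc[symmetric])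
  have tx: "t \<otimes> x = z \<otimes> t" using t xc by (simp add: z_def m_assoc)
  \<comment> \<open>Conjugation by t swaps x and z, so it fixes their product because S is abelian.
    A nontrivial product would generate S, and t would centralise S.\<close>
  have "x \<otimes> z = \<one>"
  proof (rule ccontr)
    assume n1: "x \<otimes> z \<noteq> \<one>"
    have xzS: "x \<otimes> z \<in> S" using subgroup.m_closed[OF S(1) x(1) zS] .
    have "t \<otimes> (x \<otimes> z) = z \<otimes> (t \<otimes> z)" using tx t xc zc by (simp add: m_assoc[symmetric])
    also have "\<dots> = (z \<otimes> x) \<otimes> t" using tz t xc zc by (simp add: m_assoc)
    finally have tc: "(x \<otimes> z) \<otimes> t = t \<otimes> (x \<otimes> z)" using S_comm[OF x(1) zS] by simp
    have "subgroup {a \<in> carrier G. \<forall>s\<in>{t}. comm G a s \<in> {\<one>}} G"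
      using t by (intro subgroup_comm_mem[OF one_is_normal]) simp
    then have "generate G {x \<otimes> z} \<subseteq> {a \<in> carrier G. \<forall>s\<in>{t}. comm G a s \<in> {\<one>}}"
      using tc comm1[of "x \<otimes> z" t] xc zc t by (intro generate_subgroup_incl) auto
    then have "\<forall>s\<in>S. s \<otimes> t = t \<otimes> s" using gen[OF xzS n1] comm1[OF _ t(4)] by auto
    then show False using not_central by auto
  qed
  then have "z = inv x" using xc zc by (metis inv_equality inv_inv)
  then have inverts: "t \<otimes> x = inv x \<otimes> t" using tx by simp
  have "t \<notin> generate G {x}"
    unfolding gen[OF x] using not_central S_comm by auto
  then show ?thesis
    using dihedral_embedding[OF t(4,3) xc ord5[OF x] _ inverts] by (auto simp: embeds_def)
qed

text \<open>If no ratio is 2, each further double coset contributes at most 2/9, and two of them at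
  most (2/9)^2 = 4/81. So there is just one, its ratio k is 3 or 4, |G| = (k+1)|M|, and k divides
  |M|.\<close>

theorem embeds_small_group:
  assumes P: "\<And>H. subgroup H G \<Longrightarrow> transversal_prob G H > 4 / 81"
  shows "embeds (alt_group 4) G \<or> embeds (dihedral_group 3) G \<or>
    embeds (dihedral_group 5) G \<or> embeds (dihedral_group 7) G"
proof (cases "\<exists>g\<in>carrier G. card (double_coset G M g) div card M = 2")
  case True
  then show ?thesis using card_eq_2_of_ratio_2 involution_case[OF _ P[OF M_subgroup]] by blast
next
  case False
  let ?E = "double_cosets G M - {M}"
  have finE: "finite ?E" using fin by (simp add: double_cosets_def)
  have ge3: "card D div card M \<ge> 3" if D: "D \<in> ?E" for D
  proof -
    obtain g where g: "g \<in> carrier G" "g \<notin> M" "D = double_coset G M g"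
      using proper_double_cosetE[OF M_subgroup D] .
    then have "card D div card M \<noteq> 2" using False by auto
    then show ?thesis using ratio_ge_2[OF g(1,2)] g(3) by simp
  qed
  have "transversal_prob G M \<le> (\<Prod>D\<in>?E. 2/9)"
    unfolding transversal_prob_eq_proper[OF M_subgroup fin]
    using transversal_factor_antimono[OF ge3] transversal_factor_simps(3)
    by (intro prod_mono) (auto simp: less_imp_le[OF transversal_factor_pos])
  then have pw: "(2/9 :: real) ^ card ?E > 4 / 81" using P[OF M_subgroup] by simp
  have "card ?E \<le> 1"
  proof (rule ccontr)
    assume "\<not> card ?E \<le> 1"
    then have "(2/9 :: real) ^ card ?E \<le> (2/9) ^ 2" by (intro power_decreasing) auto
    then show False using pw by (simp add: power_divide)
  qed
  moreover obtain g where g: "g \<in> carrier G" "g \<notin> M" using M_psubset by auto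
  define D where "D = double_coset G M g"
  have DE: "D \<in> ?E"
    using g double_coset_notin[OF M_subgroup g] by (simp add: D_def double_cosets_def)
  ultimately have E: "?E = {D}"
    using card_le_Suc0_iff_eq[OF finE] by auto
  define k where "k = card D div card M"
  have "transversal_prob G M = transversal_factor k"
    unfolding transversal_prob_eq_proper[OF M_subgroup fin] E k_def by simp
  then have "k < 5"
    using P[OF M_subgroup] transversal_factor_antimono[of 5 k] transversal_factor_simps(4)
    by (cases "k < 5") auto
  then have k34: "k = 3 \<or> k = 4" using ge3[OF DE] by (auto simp: k_def)
  have cD: "card D = k * card M" "k dvd card M"
    using double_coset_counts(1)[OF M_subgroup fin g(1)]
      dvdI[OF double_coset_counts(4)[OF M_subgroup fin g(1), symmetric]] by (simp_all add: k_def D_def)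
  have cG: "card (carrier G) = (k + 1) * card M"
    using card_eq_sum_proper[OF M_subgroup fin] E cD by simp
  from k34 show ?thesis
  proof
    assume "k = 3"
    then show ?thesis using four_cosets_case cG cD by simp
  next
    assume k: "k = 4"
    have "2 dvd card M" using cD(2) k by (metis dvd_trans dvd_triv_left mult_2 numeral_Bit0)
    then show ?thesis using five_cosets_case P cG k by simp
  qed
qed

end

section \<open>Reduction to the primitive case\<close>

lemma (in group_hom) normal_preimage:
  assumes N: "N \<lhd> H"
  shows "{x \<in> carrier G. h x \<in> N} \<lhd> G"
  using H.normal_invE[OF N] subgroup_preimage
  by (simp add: G.normal_inv_iff)

text \<open>The correspondence theorem. As M contains the kernel, it is the full preimage of its
  image; \<open>core\<close> says that no normal subgroup inside M properly contains the
  kernel.\<close>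

lemma (in group_hom) primitive_group_image:
  assumes fin: "finite (carrier G)" and surj: "h ` carrier G = carrier H"
    and mx: "maximal_in G M (carrier G)" and nn: "\<not> M \<lhd> G"
    and ker: "kernel G H h \<subseteq> M"
    and core: "\<And>L. L \<lhd> G \<Longrightarrow> L \<subseteq> M \<Longrightarrow> kernel G H h \<subseteq> L \<Longrightarrow> L = kernel G H h"
  shows "primitive_group H (h ` M)"
proof -
  let ?P = "\<lambda>S. {x \<in> carrier G. h x \<in> S}"
  have M: "subgroup M G" "M \<subset> carrier G" using mx by (auto simp: maximal_in_def)
  have img: "h ` ?P S = S" if "S \<subseteq> carrier H" for S using that surj by auto
  have PM: "?P (h ` M) = M"
  proof (intro equalityI subsetI)
    fix x assume "x \<in> ?P (h ` M)"
    then obtain m where m: "x \<in> carrier G" "m \<in> M" "h x = h m" by auto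
    then have mc: "m \<in> carrier G" using M by auto
    have "x \<otimes> inv m \<in> kernel G H h" using m mc by (simp add: kernel_def)
    then have "x \<otimes> inv m \<in> M" using ker by auto
    then show "x \<in> M"
      using G.subgroup_mult_right_iff[OF M(1) subgroup.m_inv_closed[OF M(1) m(2)] m(1)] by simp
  qed (use M in auto)
  have hM: "subgroup (h ` M) H" by (rule subgroup_img_is_subgroup[OF M(1)])
  have hMs: "h ` M \<subseteq> carrier H" using subgroup.subset[OF hM] .
  have core': "L = {\<one>\<^bsub>H\<^esub>}" if L: "L \<lhd> H" "L \<subseteq> h ` M" for L
  proof -
    have Ls: "subgroup L H" using L(1) normal_imp_subgroup by blast
    have "?P L \<subseteq> M" using L(2) PM by auto
    moreover have "kernel G H h \<subseteq> ?P L" using subgroup.one_closed[OF Ls] by (auto simp: kernel_def)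
    ultimately have "?P L = kernel G H h" using core[OF normal_preimage[OF L(1)]] by simp
    then have "L \<subseteq> {\<one>\<^bsub>H\<^esub>}"
      using img[OF subgroup.subset[OF Ls]] by (auto simp: kernel_def)
    then show ?thesis using subgroup.one_closed[OF Ls] by auto
  qed
  have "maximal_in H (h ` M) (carrier H)"
    unfolding maximal_in_def
  proof (intro conjI allI impI hM)
    show "h ` M \<subset> carrier H" using hMs PM M(2) surj by auto
    fix S assume S: "subgroup S H" "h ` M \<subseteq> S" "S \<subseteq> carrier H"
    have "M \<subseteq> ?P S" using S(2) M(2) by auto
    then have "?P S = M \<or> ?P S = carrier G"
      using mx subgroup_preimage[OF S(1)] unfolding maximal_in_def by simp
    then show "S = h ` M \<or> S = carrier H" using img[OF S(3)] surj by metis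
  qed
  moreover have "\<not> h ` M \<lhd> H" using normal_preimage[of "h ` M"] PM nn by auto
  moreover have "finite (carrier H)" using fin surj by (metis finite_imageI)
  ultimately show ?thesis
    using core' H.is_group by (simp add: primitive_group_def primitive_group_axioms_def)
qed

lemma has_section_iso_embeds:
  assumes "group G" "subgroup U G" "group_hom (G\<lparr>carrier := U\<rparr>) Q q" "q ` U = carrier Q" "embeds K Q"
  shows "has_section_iso G K"
  using assms has_section_iso_of_embedding unfolding embeds_def by blast

theorem nilpotent_or_section:
  assumes G: "group G" and fin: "finite (carrier G)" and tp: "tp G > 4 / 81"
  shows "nilpotent_group G \<or>
    has_section_iso G (alt_group 4) \<or> has_section_iso G (dihedral_group 3) \<or>
    has_section_iso G (dihedral_group 5) \<or> has_section_iso G (dihedral_group 7)"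
proof (cases "\<forall>U M. subgroup U G \<longrightarrow> maximal_in G M U \<longrightarrow> M \<lhd> G\<lparr>carrier := U\<rparr>")
  case True
  then show ?thesis using group.nilpotent_of_maximal_normal[OF G fin] by blast
next
  case False
  interpret G: group G by fact
  obtain U M where U: "subgroup U G" and mx: "maximal_in G M U" and nn: "\<not> M \<lhd> G\<lparr>carrier := U\<rparr>"
    using False by blast
  let ?U = "G\<lparr>carrier := U\<rparr>"
  interpret U: group ?U using G.subgroup_imp_group[OF U] .
  have finU: "finite U" using subgroup.subset[OF U] fin finite_subset by auto
  have M: "subgroup M ?U"
    using mx G.subgroup_incl[OF _ U] by (auto simp: maximal_in_def)
  have finM: "finite M" using subgroup.subset[OF M] finU finite_subset by auto
  have mxU: "maximal_in ?U M (carrier ?U)"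
    using mx M G.incl_subgroup[OF U] unfolding maximal_in_def by simp
  let ?P = "\<lambda>N. N \<lhd> ?U \<and> N \<subseteq> M"
  have "\<forall>N. ?P N \<longrightarrow> card N < Suc (card M)"
    using finM by (auto intro: card_mono less_Suc_eq_le[THEN iffD2])
  moreover have "?P {\<one>\<^bsub>?U\<^esub>}"
    using U.one_is_normal subgroup.one_closed[OF M] by simp
  \<comment> \<open>A normal subgroup of U inside M of greatest order plays the role of the core:
    none inside M properly contains it.\<close>
  ultimately obtain N where N: "?P N" "\<And>L. ?P L \<Longrightarrow> card L \<le> card N"
    using ex_has_greatest_nat[of ?P "{\<one>\<^bsub>?U\<^esub>}" card "Suc (card M)"] by blast
  interpret N: normal N ?U using N(1) by simp
  let ?q = "\<lambda>x. N #>\<^bsub>?U\<^esub> x"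
  interpret q: group_hom ?U "?U Mod N" ?q
    using N.r_coset_hom_Mod N.factorgroup_is_group U.is_group
    by (simp add: group_hom_def group_hom_axioms_def)
  have surj: "?q ` carrier ?U = carrier (?U Mod N)" by (simp add: carrier_FactGroup)
  have ker: "kernel ?U (?U Mod N) ?q = N"
  proof (intro equalityI subsetI)
    fix x assume "x \<in> kernel ?U (?U Mod N) ?q"
    then have "x \<in> U" "?q x = N" by (auto simp: kernel_def one_FactGroup)
    then show "x \<in> N" using U.rcos_self[OF _ N.subgroup_axioms, of x] by simp
  next
    fix x assume x: "x \<in> N"
    then have "x \<in> U" using N.subset by auto
    then show "x \<in> kernel ?U (?U Mod N) ?q"
      using x U.coset_join2[OF _ N.subgroup_axioms, of x] by (simp add: kernel_def one_FactGroup)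
  qed
  have "primitive_group (?U Mod N) (?q ` M)"
  proof (rule q.primitive_group_image[OF _ surj mxU nn])
    show "finite (carrier ?U)" using finU by simp
    show "kernel ?U (?U Mod N) ?q \<subseteq> M" using ker N(1) by simp
    fix L assume L: "L \<lhd> ?U" "L \<subseteq> M" "kernel ?U (?U Mod N) ?q \<subseteq> L"
    then have "card L \<le> card N" using N(2) by simp
    then show "L = kernel ?U (?U Mod N) ?q"
      using L ker card_seteq[of L N] finite_subset[OF L(2) finM] by simp
  qed
  then interpret Q: primitive_group "?U Mod N" "?q ` M" .
  have "transversal_prob (?U Mod N) H > 4 / 81" if H: "subgroup H (?U Mod N)" for H
  proof -
    let ?H = "{x \<in> carrier ?U. ?q x \<in> H}"
    have sH: "subgroup ?H ?U" by (rule q.subgroup_preimage[OF H])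
    have "4 / 81 < tp G" by fact
    also have "\<dots> \<le> transversal_prob G ?H" by (rule tp_le[OF fin G.incl_subgroup[OF U sH]])
    also have "\<dots> \<le> transversal_prob ?U ?H" by (rule G.transversal_prob_subgroup_mono[OF fin U sH])
    also have "\<dots> = transversal_prob (?U Mod N) H"
      by (rule q.transversal_prob_preimage[OF _ surj H]) (use finU in simp)
    finally show ?thesis .
  qed
  then have emb: "embeds (alt_group 4) (?U Mod N) \<or> embeds (dihedral_group 3) (?U Mod N) \<or>
      embeds (dihedral_group 5) (?U Mod N) \<or> embeds (dihedral_group 7) (?U Mod N)"
    by (rule Q.embeds_small_group)
  have qU: "?q ` U = carrier (?U Mod N)" using surj by simp
  note sec = has_section_iso_embeds[OF G U q.group_hom_axioms qU]
  from emb show ?thesis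
  proof (elim disjE)
    assume "embeds (alt_group 4) (?U Mod N)"
    from sec[OF this] show ?thesis by simp
  next
    assume "embeds (dihedral_group 3) (?U Mod N)"
    from sec[OF this] show ?thesis by simp
  next
    assume "embeds (dihedral_group 5) (?U Mod N)"
    from sec[OF this] show ?thesis by simp
  next
    assume "embeds (dihedral_group 7) (?U Mod N)"
    from sec[OF this] show ?thesis by simp
  qed
qed

section \<open>A group of order 21\<close>

text \<open>A ratio other than 1 divides |H| and 21, so it is at least 3. Since D and H are
  disjoint, 3|H| + |H| <= 21, which forces |H| = 3 and ratio 3. Each such D has 9 elements, and 9|B|
  + 3 <= 21 leaves at most two.\<close>

lemma transversal_prob_order_21:
  assumes G: "group G" and c: "card (carrier G) = 21" and H: "subgroup H G"
  shows "transversal_prob G H \<ge> 4 / 81"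
proof -
  interpret group G by fact
  have fin: "finite (carrier G)" using c by (metis card.infinite zero_neq_numeral)
  let ?k = "\<lambda>D. card D div card H"
  let ?E = "double_cosets G H - {H}"
  define B where "B = {D \<in> ?E. ?k D \<noteq> 1}"
  have finE: "finite ?E" using fin by (simp add: double_cosets_def)
  then have finB: "finite B" by (simp add: B_def)
  have sumE: "(\<Sum>D\<in>?E. card D) + card H = 21" using card_eq_sum_proper[OF H fin] c by simp
  have sumB: "(\<Sum>D\<in>B. card D) + card H \<le> 21"
  proof -
    have "B \<subseteq> ?E" by (auto simp: B_def)
    then have "(\<Sum>D\<in>B. card D) \<le> (\<Sum>D\<in>?E. card D)" using finE by (intro sum_mono2) auto
    then show ?thesis using sumE by linarith
  qed
  have dvd21: "card H dvd 21" using lagrange[OF H] c by (metis dvd_triv_right order_def)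
  have Bk: "card H = 3 \<and> ?k D = 3 \<and> card D = 9" if D: "D \<in> B" for D
  proof -
    have DE: "D \<in> ?E" and k1: "?k D \<noteq> 1" using D by (auto simp: B_def)
    obtain g where g: "g \<in> carrier G" "g \<notin> H" "D = double_coset G H g"
      using proper_double_cosetE[OF H DE] .
    have cD: "card D = ?k D * card H" using double_coset_counts(1)[OF H fin g(1)] g(3) by simp
    have kd: "?k D dvd card H" using dvdI[OF double_coset_counts(4)[OF H fin g(1), symmetric]] g(3) by simp
    have "card D \<le> (\<Sum>D\<in>B. card D)" using member_le_sum[OF D, of card] finB by simp
    then have le: "?k D * card H + card H \<le> 21" using sumB cD by simp
    have k21: "?k D dvd 21" using kd dvd21 by (rule dvd_trans)
    have div21: "d = 1 \<or> d = 3 \<or> d = 7 \<or> d = 21" if d21: "d dvd 21" for d :: nat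
    proof -
      obtain b c where bc: "d = b * c" "b dvd 3" "c dvd 7"
        using division_decomp[of d 3 7] d21 by auto
      have "prime (3::nat)" "prime (7::nat)" by simp_all
      then have "b = 1 \<or> b = 3" "c = 1 \<or> c = 7" using bc unfolding prime_nat_iff by blast+
      then show ?thesis using bc(1) by auto
    qed
    have "?k D \<ge> 3" using div21[OF k21] k1 by linarith
    then have "3 * card H \<le> ?k D * card H" by simp
    then have "card H \<le> 5" using le by linarith
    then have H3: "card H = 1 \<or> card H = 3" using div21[OF dvd21] by linarith
    have "card H \<noteq> 1" using kd k1 by auto
    then have "card H = 3" using H3 by simp
    moreover have "?k D \<le> 3" using kd \<open>card H = 3\<close> by (metis dvd_imp_le zero_less_numeral)
    ultimately show ?thesis using \<open>?k D \<ge> 3\<close> cD by simp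
  qed
  have "card B \<le> 2"
  proof (cases "B = {}")
    case False
    then have "card H = 3" using Bk by auto
    moreover have "(\<Sum>D\<in>B. card D) = 9 * card B" using Bk by simp
    ultimately show ?thesis using sumB by simp
  qed simp
  have "transversal_prob G H = (\<Prod>D\<in>B. transversal_factor (?k D))"
    unfolding transversal_prob_eq_proper[OF H fin]
    using finE transversal_factor_simps(1) by (intro prod.mono_neutral_right) (auto simp: B_def)
  also have "\<dots> = (\<Prod>D\<in>B. 2/9)"
  proof (intro prod.cong refl)
    fix D assume "D \<in> B"
    then have "?k D = 3" using Bk by blast
    then show "transversal_factor (?k D) = 2/9"
      unfolding transversal_factor_simps(3)[symmetric] by (rule arg_cong)
  qed
  also have "\<dots> = (2/9) ^ card B" by simp
  also have "\<dots> \<ge> (2/9) ^ 2" using \<open>card B \<le> 2\<close> by (intro power_decreasing) auto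
  finally show ?thesis by (simp add: power_divide)
qed

text \<open>Used to exclude sections of a group of order 21: none of 12, 6, 10, 14 divides
  21.\<close>

lemma card_dvd_of_section:
  assumes G: "group G" and sec: "has_section_iso G K"
  shows "card (carrier K) dvd card (carrier G)"
proof -
  interpret G: group G by fact
  obtain U N where U: "subgroup U G" and N: "N \<lhd> G\<lparr>carrier := U\<rparr>"
    and iso: "G\<lparr>carrier := U\<rparr> Mod N \<cong> K"
    using sec unfolding has_section_iso_def by blast
  interpret U: group "G\<lparr>carrier := U\<rparr>" using G.subgroup_imp_group[OF U] .
  have sN: "subgroup N (G\<lparr>carrier := U\<rparr>)" using N normal_imp_subgroup by blast
  have "card (carrier (G\<lparr>carrier := U\<rparr> Mod N)) dvd card U"
    using U.lagrange[OF sN] by (simp add: FactGroup_def order_def) (metis dvd_triv_left)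
  also have "card U dvd card (carrier G)" using G.lagrange[OF U] by (metis dvd_triv_right order_def)
  finally show ?thesis using iso_same_card[OF iso] by simp
qed

text \<open>The number \<open>a + 7b\<close> with \<open>a < 7\<close> and \<open>b < 3\<close> stands for the map \<open>x \<mapsto> a + 2\<^sup>b x\<close> on the integers
  modulo 7.\<close>

definition affine_21 :: "nat monoid" where
  "affine_21 = \<lparr>carrier = {0..<21},
     mult = (\<lambda>x y. (x mod 7 + 2 ^ (x div 7) * (y mod 7)) mod 7 + 7 * ((x div 7 + y div 7) mod 3)),
     one = 0\<rparr>"

text \<open>2^3 = 8 is 1 modulo 7, so the exponent of a slope may be reduced modulo 3. Associativity
  depends on this.\<close>

lemma power_2_mod_7: "(2::nat) ^ (n mod 3) mod 7 = 2 ^ n mod 7"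
proof -
  have "(2::nat) ^ n = 2 ^ (3 * (n div 3) + n mod 3)" by simp
  also have "\<dots> = 8 ^ (n div 3) * 2 ^ (n mod 3)" unfolding power_add power_mult by simp
  also have "\<dots> mod 7 = ((8 mod 7) ^ (n div 3) mod 7) * 2 ^ (n mod 3) mod 7"
    by (metis mod_mult_left_eq power_mod)
  finally show ?thesis by simp
qed

lemma affine_21_mod:
  "(x \<otimes>\<^bsub>affine_21\<^esub> y) mod 7 = (x mod 7 + 2 ^ (x div 7) * (y mod 7)) mod 7"
  "(x \<otimes>\<^bsub>affine_21\<^esub> y) div 7 = (x div 7 + y div 7) mod 3"
  by (simp_all add: affine_21_def)

lemma affine_21_is_group: "group affine_21"
proof -
  have e: "u = v" if "u mod 7 = v mod 7" "u div 7 = v div 7" for u v :: nat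
    using that by (metis div_mult_mod_eq)
  have lt: "a mod 7 + 7 * (b mod 3) < 21" for a b :: nat
    using mod_less_divisor[of 7 a] mod_less_divisor[of 3 b] by linarith
  show ?thesis
  proof (rule groupI)
    fix x y assume "x \<in> carrier affine_21" "y \<in> carrier affine_21"
    show "x \<otimes>\<^bsub>affine_21\<^esub> y \<in> carrier affine_21" unfolding affine_21_def using lt by simp
  next
    fix x y z :: nat
    let ?m = "mult affine_21"
    show "?m (?m x y) z = ?m x (?m y z)"
    proof (rule e)
      have "?m (?m x y) z mod 7 =
          ((x mod 7 + 2 ^ (x div 7) * (y mod 7)) mod 7 + 2 ^ ((x div 7 + y div 7) mod 3) * (z mod 7)) mod 7"
        by (simp only: affine_21_mod)
      also have "\<dots> = (x mod 7 + 2 ^ (x div 7) * (y mod 7) + 2 ^ (x div 7 + y div 7) * (z mod 7)) mod 7"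
        by (intro mod_add_cong mod_mult_cong mod_mod_trivial power_2_mod_7 refl)
      also have "\<dots> = (x mod 7 + 2 ^ (x div 7) * (y mod 7 + 2 ^ (y div 7) * (z mod 7))) mod 7"
        by (simp add: power_add algebra_simps)
      also have "\<dots> = (x mod 7 + 2 ^ (x div 7) * ((y mod 7 + 2 ^ (y div 7) * (z mod 7)) mod 7)) mod 7"
        by (intro mod_add_cong mod_mult_cong mod_mod_trivial[symmetric] refl)
      also have "\<dots> = ?m x (?m y z) mod 7" by (simp only: affine_21_mod)
      finally show "?m (?m x y) z mod 7 = ?m x (?m y z) mod 7" .
      show "?m (?m x y) z div 7 = ?m x (?m y z) div 7"
        by (simp add: affine_21_mod mod_simps add.assoc)
    qed
  next
    fix x assume "x \<in> carrier affine_21"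
    then have "x div 7 < 3" by (simp add: affine_21_def)
    \<comment> \<open>The inverse map has slope 2^-b and translation part -2^-b a; the outer
      reductions turn 3 and 7 into 0.\<close>
    let ?b = "(3 - x div 7) mod 3"
    let ?w = "2 ^ ?b * (x mod 7)"
    let ?y = "(7 - ?w mod 7) mod 7 + 7 * ?b"
    have y: "?y mod 7 = (7 - ?w mod 7) mod 7" "?y div 7 = ?b" by simp_all
    have "?y \<in> carrier affine_21"
      unfolding affine_21_def using lt by simp
    moreover have "?y \<otimes>\<^bsub>affine_21\<^esub> x = 0"
    proof (rule e)
      have "(?y \<otimes>\<^bsub>affine_21\<^esub> x) mod 7 = ((7 - ?w mod 7) mod 7 + ?w) mod 7"
        unfolding affine_21_mod y ..
      also have "\<dots> = (7 - ?w mod 7 + ?w mod 7) mod 7"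
        by (intro mod_add_cong mod_mod_trivial mod_mod_trivial[symmetric])
      also have "\<dots> = 0 mod 7" using mod_less_divisor[of 7 ?w] by simp
      finally show "(?y \<otimes>\<^bsub>affine_21\<^esub> x) mod 7 = 0 mod 7" .
      have "(?y \<otimes>\<^bsub>affine_21\<^esub> x) div 7 = (?b + x div 7) mod 3"
        unfolding affine_21_mod y ..
      also have "\<dots> = (3 - x div 7 + x div 7) mod 3" by (rule mod_add_left_eq)
      also have "\<dots> = 0 div 7" using \<open>x div 7 < 3\<close> by simp
      finally show "(?y \<otimes>\<^bsub>affine_21\<^esub> x) div 7 = 0 div 7" .
    qed
    moreover have "\<one>\<^bsub>affine_21\<^esub> = 0" by (simp add: affine_21_def)
    ultimately show "\<exists>y\<in>carrier affine_21. y \<otimes>\<^bsub>affine_21\<^esub> x = \<one>\<^bsub>affine_21\<^esub>" by metis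
  qed (auto simp: affine_21_def)
qed

text \<open>The codes below 7 are the translations, and they survive in every term of the lower
  central series.\<close>

lemma affine_21_not_nilpotent: "\<not> nilpotent_group affine_21"
proof -
  interpret group affine_21 by (rule affine_21_is_group)
  have "{0..<7} \<subseteq> lower_central_series affine_21 n" for n
  proof (induction n)
    case 0
    show ?case by (auto simp: affine_21_def)
  next
    case (Suc n)
    show ?case
    proof
      fix c :: nat assume c: "c \<in> {0..<7}"
      \<comment> \<open>The code 7 is the doubling map. The commutator of the translation by -c with
        it is the translation by -c + 2c = c.\<close>
      let ?x = "(7 - c) mod 7"
      have x: "?x \<in> lower_central_series affine_21 n" using Suc by auto
      have xc: "?x \<in> carrier affine_21" "7 \<in> carrier affine_21" "c \<in> carrier affine_21"
        using c mod_less_divisor[of 7 "7 - c"] by (simp_all add: affine_21_def)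
      have "c = 0 \<or> c = 1 \<or> c = 2 \<or> c = 3 \<or> c = 4 \<or> c = 5 \<or> c = 6" using c by auto
      then have "c \<otimes>\<^bsub>affine_21\<^esub> (7 \<otimes>\<^bsub>affine_21\<^esub> ?x) = ?x \<otimes>\<^bsub>affine_21\<^esub> 7"
        by (elim disjE) (simp_all add: affine_21_def)
      then have "c \<otimes>\<^bsub>affine_21\<^esub> (7 \<otimes>\<^bsub>affine_21\<^esub> ?x) = comm affine_21 ?x 7 \<otimes>\<^bsub>affine_21\<^esub> (7 \<otimes>\<^bsub>affine_21\<^esub> ?x)"
        using comm_mult[OF xc(1,2)] by simp
      then have "c = comm affine_21 ?x 7"
        using xc right_cancel[of "7 \<otimes>\<^bsub>affine_21\<^esub> ?x" c "comm affine_21 ?x 7"] by simp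
      then show "c \<in> lower_central_series affine_21 (Suc n)"
        using x xc(2) unfolding lower_central_series.simps comm_def
        by (intro generate.incl) blast
    qed
  qed
  moreover have "1 \<in> {0..<7::nat}" by simp
  ultimately have one: "1 \<in> lower_central_series affine_21 n" for n by (rule subsetD)
  have "lower_central_series affine_21 n \<noteq> {\<one>\<^bsub>affine_21\<^esub>}" for n
  proof
    assume "lower_central_series affine_21 n = {\<one>\<^bsub>affine_21\<^esub>}"
    then have "1 \<in> {\<one>\<^bsub>affine_21\<^esub>}" using one[of n] by simp
    then show False by (simp add: affine_21_def)
  qed
  then show ?thesis by (simp add: nilpotent_group_def)
qed

lemma tp_affine_21: "tp affine_21 \<ge> 4 / 81"
proof -
  have fin: "finite (carrier affine_21)" and c: "card (carrier affine_21) = 21"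
    by (simp_all add: affine_21_def)
  interpret group affine_21 by (rule affine_21_is_group)
  show ?thesis
    unfolding tp_def
  proof (rule Min.boundedI[OF finite_transversal_probs[OF fin]])
    show "{transversal_prob affine_21 H | H. subgroup H affine_21} \<noteq> {}" using subgroup_self by auto
  qed (use transversal_prob_order_21[OF affine_21_is_group c] in auto)
qed

lemma affine_21_no_section:
  assumes "\<not> card (carrier K) dvd 21"
  shows "\<not> has_section_iso affine_21 K"
  using card_dvd_of_section[OF affine_21_is_group, of K] assms by (auto simp: affine_21_def)

lemma card_alt_group_4: "card (carrier (alt_group 4)) = 12"
  using alt_group_card_carrier[of 4] by (simp add: fact_numeral)

theorem theorem4p5:
  shows "(\<forall>G :: ('a, 'b) monoid_scheme.
            group G \<and> finite (carrier G) \<and> tp G > 4 / 81 \<longrightarrow>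
            nilpotent_group G \<or>
            has_section_iso G (alt_group 4) \<or> has_section_iso G (dihedral_group 3) \<or>
            has_section_iso G (dihedral_group 5) \<or> has_section_iso G (dihedral_group 7)) \<and>
         (\<forall>c :: real. c < 4 / 81 \<longrightarrow>
            \<not> (\<forall>G :: nat monoid.
                  group G \<and> finite (carrier G) \<and> tp G > c \<longrightarrow>
                  nilpotent_group G \<or>
                  has_section_iso G (alt_group 4) \<or> has_section_iso G (dihedral_group 3) \<or>
                  has_section_iso G (dihedral_group 5) \<or> has_section_iso G (dihedral_group 7)))"
proof (intro conjI allI impI notI)
  fix G :: "('a, 'b) monoid_scheme"
  assume "group G \<and> finite (carrier G) \<and> tp G > 4 / 81"
  then show "nilpotent_group G \<or>
      has_section_iso G (alt_group 4) \<or> has_section_iso G (dihedral_group 3) \<or>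
      has_section_iso G (dihedral_group 5) \<or> has_section_iso G (dihedral_group 7)"
    using nilpotent_or_section by (elim conjE)
next
  fix c :: real
  assume c: "c < 4 / 81" and all: "\<forall>G :: nat monoid. group G \<and> finite (carrier G) \<and> tp G > c \<longrightarrow>
      nilpotent_group G \<or>
      has_section_iso G (alt_group 4) \<or> has_section_iso G (dihedral_group 3) \<or>
      has_section_iso G (dihedral_group 5) \<or> has_section_iso G (dihedral_group 7)"
  \<comment> \<open>One group refutes every c at once, because its \<open>tp\<close> is at least
    4/81.\<close>
  have "group affine_21 \<and> finite (carrier affine_21) \<and> tp affine_21 > c"
    using affine_21_is_group tp_affine_21 c by (simp add: affine_21_def)
  from all[rule_format, OF this] show False
    using affine_21_not_nilpotent affine_21_no_section[of "alt_group 4"]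
      affine_21_no_section[of "dihedral_group 3"] affine_21_no_section[of "dihedral_group 5"]
      affine_21_no_section[of "dihedral_group 7"] card_alt_group_4 order_dihedral_group
    unfolding order_def by simp
qed

end
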